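(* Let $\varphi:\mathbb{R}\to\mathbb{R}_+$ be a given convex loss function, let $M\ge 2$ be a fixed number of base functions $h_1,\dots,h_M:\mathcal{X}\to[-K,K]$ ($K>0$ a constant), and let $\lambda>0$ be fixed. Let the estimate $\widehat\theta_t$ be defined by the recursive algorithm described in the context (mirror descent with averaging, with the entropy type proxy function, $\gamma_i\equiv 1$, $\beta_i=\beta_0\sqrt{i+1}$, $\beta_0=L_\varphi(\lambda)(\ln M)^{-1/2}$, and an initial value $\theta_0\in\Theta_{M,\lambda}$). Then, for any integer $t\ge 1$, $$\mathbb{E}\,A(\widehat\theta_t)-\min_{\theta\in\Theta_{M,\lambda}}A(\theta)\le C\,\frac{(\ln M)^{1/2}\sqrt{t+1}}{t},$$ where $C=C(\varphi,\lambda)=2\lambda L_\varphi(\lambda)$ and $L_\varphi(\lambda)=K\sup_{x\in[-K\lambda,K\lambda]}|\varphi'(x)|$.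
   Context: Setting. $(X,Y)$ is a random pair with values in $\mathcal{X}\times\{-1,+1\}$, where $\mathcal{X}$ is a feature space; no other assumption is made on its distribution. $(X_1,Y_1),(X_2,Y_2),\dots$ are independent pairs with the same distribution as $(X,Y)$. Put $H(x)=(h_1(x),\dots,h_M(x))^T$. The $\lambda$-simplex is $$\Theta_{M,\lambda}=\Big\{\theta=(\theta^{(1)},\dots,\theta^{(M)})^T\in\mathbb{R}^M_+:\ \sum_{i=1}^M\theta^{(i)}=\lambda\Big\}.$$ The $\varphi$-risk is $A(\theta)=\mathbb{E}\,\varphi(Y\theta^TH(X))$. $\varphi'$ denotes an arbitrary monotone version of the derivative of $\varphi$ (e.g. the right continuous one). The stochastic sub-gradients are $$u_i(\theta)=\varphi'(Y_i\theta^TH(X_i))\,Y_iH(X_i)\in\mathbb{R}^M,\quad i=1,2,\dots.$$ Algorithm. Let $\beta_0=L_\varphi(\lambda)(\ln M)^{-1/2}$ and $\beta_i=\beta_0\sqrt{i+1}$ for $i\ge 1$ (the $\beta_i$ are positive). For $\beta>0$ and $z\in\mathbb{R}^M$ let $W_\beta(z)=\sup_{\theta\in\Theta_{M,\lambda}}\{-z^T\theta-\beta V(\theta)\}$ be the $\beta$-conjugate of the entropy type proxy function $V(\theta)=\lambda\ln(M/\lambda)+\sum_{j=1}^M\theta^{(j)}\ln\theta^{(j)}$ (with $0\ln 0=0$); explicitly, $W_\beta(z)=\lambda\beta\ln\big(\frac1M\sum_{k=1}^Me^{-z^{(k)}/\beta}\big)$, and the $j$-th component of $-\nabla W_\beta(z)$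 is $\lambda e^{-z^{(j)}/\beta}\big/\sum_{k=1}^Me^{-z^{(k)}/\beta}$. Fix the initial values $\zeta_0=0\in\mathbb{R}^M$ and $\theta_0\in\Theta_{M,\lambda}$. For $i=1,2,\dots$ set $$\zeta_i=\zeta_{i-1}+u_i(\theta_{i-1}),\qquad \theta_i=-\nabla W_{\beta_i}(\zeta_i).$$ The output at iteration $t\ge1$ is $\widehat\theta_t=\frac1t\sum_{i=1}^t\theta_{i-1}$ (recursively, $\widehat\theta_i=\widehat\theta_{i-1}-\frac1i(\widehat\theta_{i-1}-\theta_{i-1})$), which depends only on $(X_1,Y_1),\dots,(X_{t-1},Y_{t-1})$. *)

theory Defs
  imports "HOL-Probability.Probability"
begin

definition lam_simplex :: "real \<Rightarrow> (real ^ 'm) set" where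
  "lam_simplex lam = {\<theta>. (\<forall>j. 0 \<le> \<theta> $ j) \<and> (\<Sum>j\<in>UNIV. \<theta> $ j) = lam}"

text \<open>The convention \<open>0 * ln 0 = 0\<close> holds automatically.\<close>
definition entropy_proxy :: "real \<Rightarrow> real ^ 'm \<Rightarrow> real" where
  "entropy_proxy lam \<theta> =
     lam * ln (real CARD('m) / lam) + (\<Sum>j\<in>UNIV. \<theta> $ j * ln (\<theta> $ j))"

definition conj_proxy :: "real \<Rightarrow> real \<Rightarrow> real ^ 'm \<Rightarrow> real" where
  "conj_proxy lam \<beta> z =
     (SUP \<theta>\<in>lam_simplex lam. - (z \<bullet> \<theta>) - \<beta> * entropy_proxy lam \<theta>)"

definition grad :: "('a::real_inner \<Rightarrow> real) \<Rightarrow> 'a \<Rightarrow> 'a" where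
  "grad f z = (THE D. GDERIV f z :> D)"

text \<open>Every monotone such \<open>d\<close> is allowed; at the kinks of \<open>\<phi>\<close> its value is not prescribed.\<close>
definition monotone_derivative_version :: "(real \<Rightarrow> real) \<Rightarrow> (real \<Rightarrow> real) \<Rightarrow> bool" where
  "monotone_derivative_version \<phi> d \<longleftrightarrow>
     mono d \<and> (\<forall>x. \<phi> differentiable (at x) \<longrightarrow> (\<phi> has_real_derivative d x) (at x))"

definition L_const :: "(real \<Rightarrow> real) \<Rightarrow> real \<Rightarrow> real \<Rightarrow> real" where
  "L_const d K lam = K * (SUP x\<in>{- (K * lam)..K * lam}. \<bar>d x\<bar>)"

definition feature_map :: "('m::finite \<Rightarrow> 'x \<Rightarrow> real) \<Rightarrow> 'x \<Rightarrow> real ^ 'm" where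
  "feature_map h x = (\<chi> j. h j x)"

definition phi_risk :: "'w measure \<Rightarrow> ('w \<Rightarrow> 'x) \<Rightarrow> ('w \<Rightarrow> real) \<Rightarrow> (real \<Rightarrow> real) \<Rightarrow>
    ('m::finite \<Rightarrow> 'x \<Rightarrow> real) \<Rightarrow> real ^ 'm \<Rightarrow> real" where
  "phi_risk P X Y \<phi> h \<theta> = (\<integral>\<omega>. \<phi> (Y \<omega> * (\<theta> \<bullet> feature_map h (X \<omega>))) \<partial>P)"

definition stoch_subgrad :: "(real \<Rightarrow> real) \<Rightarrow> ('m::finite \<Rightarrow> 'x \<Rightarrow> real) \<Rightarrow> 'x \<Rightarrow> real \<Rightarrow>
    real ^ 'm \<Rightarrow> real ^ 'm" where
  "stoch_subgrad d h x y \<theta> =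
     (d (y * (\<theta> \<bullet> feature_map h x)) * y) *\<^sub>R feature_map h x"

text \<open>With \<open>M\<close> base functions; at \<open>i = 0\<close> the formula gives \<open>\<beta>\<^sub>0\<close> itself.\<close>
definition md_beta :: "real \<Rightarrow> nat \<Rightarrow> nat \<Rightarrow> real" where
  "md_beta L M i = L * ln (real M) powr (- 1 / 2) * sqrt (real i + 1)"

text \<open>The pair \<open>(\<zeta>\<^sub>i, \<theta>\<^sub>i)\<close>, for step parameters \<open>\<beta>\<close> and sub-gradient oracles \<open>u\<close>;
  the oracle \<open>u i\<close> is used from \<open>i = 1\<close> on.\<close>
primrec md_state :: "real \<Rightarrow> (nat \<Rightarrow> real) \<Rightarrow> (nat \<Rightarrow> real ^ 'm \<Rightarrow> real ^ 'm) \<Rightarrow> real ^ 'm \<Rightarrow>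
    nat \<Rightarrow> (real ^ 'm) \<times> (real ^ 'm)" where
  "md_state lam \<beta> u \<theta>0 0 = (0, \<theta>0)"
| "md_state lam \<beta> u \<theta>0 (Suc i) =
     (let \<zeta> = fst (md_state lam \<beta> u \<theta>0 i) + u (Suc i) (snd (md_state lam \<beta> u \<theta>0 i))
      in (\<zeta>, - grad (conj_proxy lam (\<beta> (Suc i))) \<zeta>))"

definition md_average :: "real \<Rightarrow> (nat \<Rightarrow> real) \<Rightarrow> (nat \<Rightarrow> real ^ 'm \<Rightarrow> real ^ 'm) \<Rightarrow> real ^ 'm \<Rightarrow>
    nat \<Rightarrow> real ^ 'm" where
  "md_average lam \<beta> u \<theta>0 t =
     (1 / real t) *\<^sub>R (\<Sum>i=1..t. snd (md_state lam \<beta> u \<theta>0 (i - 1)))"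

definition md_estimate :: "(real \<Rightarrow> real) \<Rightarrow> ('m::finite \<Rightarrow> 'x \<Rightarrow> real) \<Rightarrow> real \<Rightarrow> real \<Rightarrow> real ^ 'm \<Rightarrow>
    (nat \<Rightarrow> 'x) \<Rightarrow> (nat \<Rightarrow> real) \<Rightarrow> nat \<Rightarrow> real ^ 'm" where
  "md_estimate d h K lam \<theta>0 xs ys t =
     md_average lam (md_beta (L_const d K lam) CARD('m))
       (\<lambda>i. stoch_subgrad d h (xs i) (ys i)) \<theta>0 t"

end

theory Submission
  imports Defs
begin

text \<open>
  The iterates are \<open>\<lambda>\<close> times exponential weights \<open>p\<^sub>i \<propto> exp (- \<zeta>\<^sub>i / \<beta>\<^sub>i)\<close>. A monotone version
  \<open>d\<close> of the derivative is a subgradient of \<open>\<phi>\<close> everywhere, so the excess losses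
  \<open>\<phi> (Y\<^sub>i \<theta>\<^sub>i\<^sub>-\<^sub>1\<cdot>H) - \<phi> (Y\<^sub>i \<theta>\<cdot>H)\<close> are bounded pointwise by the linear regret
  \<open>u\<^sub>i\<cdot>(\<theta>\<^sub>i\<^sub>-\<^sub>1 - \<theta>)\<close>, which is bounded for every sequence of data; taking expectations (\<open>\<theta>\<^sub>i\<^sub>-\<^sub>1\<close> is
  independent of \<open>(X\<^sub>i, Y\<^sub>i)\<close>) and using convexity of the risk gives the theorem.

  The usual potential argument with the log-sum-exp function \<open>W\<^sub>\<beta>\<close> yields the constant \<open>2\<close> when
  \<open>\<theta>\<^sub>0\<close> is the barycentre. For an arbitrary \<open>\<theta>\<^sub>0\<close> it gives, with \<open>s = sqrt (ln M)\<close>, \<open>n = i + 1\<close> and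
  normalised losses,
  \<open>r\<^sub>i \<le> C + s (sqrt n + sqrt (n - 1/2) - sqrt (3/2)) - b\<^sub>i D\<^sub>i\<close>, where \<open>D\<^sub>i = - ln p\<^sub>i\<^sub>,\<^sub>k\<close> for the
  comparator \<open>k\<close> and \<open>C\<close> is the price of the first round. One then shows \<open>r\<^sub>i \<le> 2 s sqrt (i + 1)\<close> by
  induction: if \<open>1 - p\<^sub>i\<^sub>,\<^sub>k\<close> is small, round \<open>i + 1\<close> costs at most \<open>2 (1 - p\<^sub>i\<^sub>,\<^sub>k)\<close>, which the right-hand
  side absorbs; otherwise the term \<open>b\<^sub>i D\<^sub>i\<close> is large enough to pay for \<open>C\<close>.
\<close>

section \<open>Exponential weights\<close>

text \<open>Hoeffding's lemma for a finite law: the chord of \<open>exp\<close> over [-1, 1]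
  replaces the law of \<open>x\<close> by a law on {-1, 1} with the same mean, to which
  \<open>Hoeffdings_lemma_aux\<close> applies.\<close>

lemma finite_Hoeffding:
  fixes p x :: "'i \<Rightarrow> real"
  assumes "\<And>j. j \<in> I \<Longrightarrow> 0 \<le> p j" and p1: "sum p I = 1"
    and x: "\<And>j. j \<in> I \<Longrightarrow> \<bar>x j\<bar> \<le> 1" and h: "0 \<le> h"
  shows "ln (\<Sum>j\<in>I. p j * exp (- (h * x j))) \<le> - h * (\<Sum>j\<in>I. p j * x j) + h\<^sup>2 / 2"
proof -
  define m where "m = (\<Sum>j\<in>I. p j * x j)"
  \<comment> \<open>\<open>P\<close> is the mass at -1 of the law on {-1, 1} with mean
    \<open>m\<close>.\<close>
  define P where "P = (1 - m) / 2"
  have I: "finite I" "I \<noteq> {}" using p1 by (auto intro: sum.infinite ccontr)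
  have m1: "m \<le> 1"
  proof -
    have "m \<le> (\<Sum>j\<in>I. p j * 1)"
      unfolding m_def using assms(1) x by (intro sum_mono mult_left_mono) (auto simp: abs_le_iff)
    then show ?thesis using p1 by simp
  qed
  have chord: "exp (- (h * x j)) \<le> (1 + x j) / 2 * exp (- h) + (1 - x j) / 2 * exp h" if "j \<in> I" for j
  proof -
    have "exp (h * ((1 - (1 - x j) / 2) *\<^sub>R (-1) + ((1 - x j) / 2) *\<^sub>R 1))
        \<le> (1 - (1 - x j) / 2) * exp (h * -1) + ((1 - x j) / 2) * exp (h * 1)"
      using x[OF that] by (intro convex_onD[OF convex_on_exp[OF h]]) (auto simp: abs_le_iff)
    moreover have "h * ((1 - (1 - x j) / 2) *\<^sub>R (-1) + ((1 - x j) / 2) *\<^sub>R 1) = - (h * x j)"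
      by (simp add: field_simps)
    ultimately show ?thesis by (simp add: field_simps)
  qed
  have "(\<Sum>j\<in>I. p j * exp (- (h * x j)))
      \<le> (\<Sum>j\<in>I. p j * ((1 + x j) / 2 * exp (- h) + (1 - x j) / 2 * exp h))"
    using assms(1) chord by (intro sum_mono mult_left_mono) auto
  also have "\<dots> = (\<Sum>j\<in>I. p j * ((exp (- h) + exp h) / 2) + (p j * x j) * ((exp (- h) - exp h) / 2))"
    by (intro sum.cong) (auto simp: field_simps)
  also have "\<dots> = (exp (- h) + exp h) / 2 + m * ((exp (- h) - exp h) / 2)"
    by (simp only: sum.distrib sum_distrib_right[symmetric] p1 m_def mult_1)
  \<comment> \<open>The two exponents -h and h differ by \<open>2 * h\<close>, hence the later use
    of \<open>Hoeffdings_lemma_aux\<close> at \<open>2 * h\<close>.\<close>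
  also have "\<dots> = exp (- h) * (1 + P * (exp (2 * h) - 1))"
  proof -
    have "exp (- h) * exp (2 * h) = exp h" by (simp add: exp_add[symmetric])
    then have "exp (- h) * (1 + P * (exp (2 * h) - 1)) = exp (-h) + P * exp h - P * exp (-h)"
      by (simp add: algebra_simps)
    then show ?thesis by (simp add: P_def field_simps)
  qed
  finally have le: "(\<Sum>j\<in>I. p j * exp (- (h * x j))) \<le> exp (- h) * (1 + P * (exp (2 * h) - 1))" .
  have pos: "0 < (\<Sum>j\<in>I. p j * exp (- (h * x j)))"
  proof -
    obtain k where "k \<in> I" "0 < p k"
    proof (rule ccontr)
      assume "\<not> thesis"
      then have "\<And>k. k \<in> I \<Longrightarrow> p k = 0" using assms(1) that by force
      then show False using p1 by simp
    qed
    then show ?thesis using I assms(1) by (intro sum_pos2[of _ k]) auto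
  qed
  have P0: "0 \<le> P" using m1 by (simp add: P_def)
  have pos2: "0 < 1 + P * (exp (2 * h) - 1)"
    using P0 h by (intro add_pos_nonneg mult_nonneg_nonneg) auto
  have "ln (\<Sum>j\<in>I. p j * exp (- (h * x j))) \<le> ln (exp (- h) * (1 + P * (exp (2 * h) - 1)))"
    using le pos by (intro ln_mono) auto
  also have "\<dots> = - h + ln (1 + P * (exp (2 * h) - 1))"
    using pos2 by (simp add: ln_mult)
  also have "\<dots> \<le> - h + (2 * h * P + (2 * h)\<^sup>2 / 8)"
    using Hoeffdings_lemma_aux[of "2 * h" P] h P0 by simp
  also have "\<dots> = - h * m + h\<^sup>2 / 2"
    by (simp add: P_def field_simps power2_eq_square)
  finally show ?thesis by (simp add: m_def)
qed

text \<open>This is the conjugate of the entropy proxy divided by \<open>lam\<close> (see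
  \<open>conj_proxy_eq_lse\<close>), normalised to vanish at z = 0.\<close>

definition lse :: "real \<Rightarrow> ('m::finite \<Rightarrow> real) \<Rightarrow> real" where
  "lse b z = b * ln ((\<Sum>j\<in>UNIV. exp (- (z j / b))) / real CARD('m))"

definition softmin :: "real \<Rightarrow> ('m::finite \<Rightarrow> real) \<Rightarrow> 'm \<Rightarrow> real" where
  "softmin b z j = exp (- (z j / b)) / (\<Sum>k\<in>UNIV. exp (- (z k / b)))"

lemma sum_exp_pos: "0 < (\<Sum>k\<in>(UNIV::'m::finite set). exp (f k :: real))"
  by (intro sum_pos) auto

lemma softmin_pos: "0 < softmin b z j"
  unfolding softmin_def by (intro divide_pos_pos sum_exp_pos) auto

lemma softmin_nonneg: "0 \<le> softmin b z j"
  by (rule less_imp_le[OF softmin_pos])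

lemma sum_softmin: "(\<Sum>j\<in>UNIV. softmin b z j) = 1"
  using sum_exp_pos[of "\<lambda>k. - (z k / b)"] by (simp add: softmin_def sum_divide_distrib[symmetric])

lemma ln_le_iff_le_exp: "0 < x \<Longrightarrow> ln x \<le> y \<longleftrightarrow> x \<le> exp (y::real)"
  by (metis exp_gt_zero ln_exp ln_le_cancel_iff)

text \<open>The partition sum is multiplied by the \<open>softmin\<close>-average of
  \<open>exp (- (u j / b))\<close>, whose logarithm is bounded by Hoeffding's lemma at
  \<open>1 / b\<close>. The linear term is the loss of the round, and \<open>1 / (2 * b)\<close> is
  its price.\<close>

lemma lse_add:
  fixes z u :: "'m::finite \<Rightarrow> real"
  assumes u: "\<And>j. \<bar>u j\<bar> \<le> 1" and b: "0 < b"
  shows "lse b (\<lambda>j. z j + u j) \<le> lse b z - (\<Sum>j\<in>UNIV. softmin b z j * u j) + 1 / (2 * b)"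
proof -
  let ?S = "\<Sum>j\<in>UNIV. exp (- (z j / b))"
  let ?p = "softmin b z"
  have S: "0 < ?S" by (rule sum_exp_pos)
  have pos: "0 < (\<Sum>j\<in>UNIV. ?p j * exp (- (1 / b * u j)))"
    by (intro sum_pos mult_pos_pos softmin_pos) auto
  have "(\<Sum>j\<in>UNIV. exp (- ((z j + u j) / b))) = ?S * (\<Sum>j\<in>UNIV. ?p j * exp (- (1 / b * u j)))"
    unfolding sum_distrib_left
  proof (intro sum.cong refl)
    fix j
    have "exp (- ((z j + u j) / b)) = exp (- (z j / b)) * exp (- (1 / b * u j))"
      by (simp add: exp_add[symmetric] add_divide_distrib)
    then show "exp (- ((z j + u j) / b)) = ?S * (?p j * exp (- (1 / b * u j)))"
      using S by (simp add: softmin_def)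
  qed
  then have "lse b (\<lambda>j. z j + u j)
      = b * ln (?S / real CARD('m) * (\<Sum>j\<in>UNIV. ?p j * exp (- (1 / b * u j))))"
    by (simp add: lse_def)
  also have "\<dots> = lse b z + b * ln (\<Sum>j\<in>UNIV. ?p j * exp (- (1 / b * u j)))"
    using S pos by (subst ln_mult) (auto simp: lse_def algebra_simps)
  also have "\<dots> \<le> lse b z + b * (- (1 / b) * (\<Sum>j\<in>UNIV. ?p j * u j) + (1 / b)\<^sup>2 / 2)"
    using b u by (intro add_left_mono mult_left_mono finite_Hoeffding)
      (auto simp: softmin_nonneg sum_softmin)
  also have "\<dots> = lse b z - (\<Sum>j\<in>UNIV. ?p j * u j) + 1 / (2 * b)"
    using b by (simp add: field_simps power2_eq_square)
  finally show ?thesis .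
qed

text \<open>Monotonicity of power means in logarithmic form. It lets the potential pass to a larger
  step parameter at no cost.\<close>

lemma lse_antimono:
  fixes z :: "'m::finite \<Rightarrow> real"
  assumes "0 < b" "b \<le> b'"
  shows "lse b' z \<le> lse b z"
proof -
  define S where "S = (\<Sum>j\<in>UNIV. exp (- (z j / b)))"
  define r where "r = b / b'"
  define l where "l = ln (S / real CARD('m))"
  have S: "0 < S" unfolding S_def by (rule sum_exp_pos)
  have el: "exp (- l) = real CARD('m) / S" using S by (simp add: l_def exp_minus)
  have r: "0 \<le> r" "r \<le> 1" using assms by (auto simp: r_def)
  \<comment> \<open>The shift by \<open>l\<close> makes the numbers
    \<open>exp (- (z j / b) - l)\<close> average to 1. Convexity of \<open>exp\<close> between 0 and
    that exponent, with weight \<open>r\<close>, carries this bound over to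
    \<open>b'\<close>.\<close>
  have "exp (- (z j / b') - r * l) \<le> (1 - r) + r * (exp (- (z j / b)) * exp (- l))" for j
  proof -
    have "exp ((1 - r) *\<^sub>R 0 + r *\<^sub>R (- (z j / b) - l)) \<le> (1 - r) * exp 0 + r * exp (- (z j / b) - l)"
      using r by (intro convex_onD[OF exp_convex]) auto
    moreover have "(1 - r) *\<^sub>R 0 + r *\<^sub>R (- (z j / b) - l) = - (z j / b') - r * l"
      using assms by (simp add: r_def field_simps)
    moreover have "exp (- (z j / b) - l) = exp (- (z j / b)) * exp (- l)"
      by (simp add: exp_add[symmetric])
    ultimately show ?thesis by simp
  qed
  then have "(\<Sum>j\<in>UNIV. exp (- (z j / b') - r * l))
      \<le> (\<Sum>j\<in>(UNIV::'m set). (1 - r) + r * (exp (- (z j / b)) * exp (- l)))"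
    by (intro sum_mono) auto
  also have "\<dots> = real CARD('m) * (1 - r) + r * (S * exp (- l))"
    by (simp add: sum.distrib sum_distrib_left[symmetric] sum_distrib_right[symmetric] S_def)
  also have "\<dots> = real CARD('m)" using S by (simp add: el field_simps)
  finally have "(\<Sum>j\<in>UNIV. exp (- (z j / b'))) / exp (r * l) \<le> real CARD('m)"
    by (simp add: exp_diff sum_divide_distrib)
  then have "(\<Sum>j\<in>UNIV. exp (- (z j / b'))) / real CARD('m) \<le> exp (r * l)"
    by (simp add: field_simps)
  then have "ln ((\<Sum>j\<in>UNIV. exp (- (z j / b'))) / real CARD('m)) \<le> r * l"
    using sum_exp_pos[of "\<lambda>j. - (z j / b')"] by (subst ln_le_iff_le_exp) auto
  then have "lse b' z \<le> b' * (r * l)"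
    unfolding lse_def using assms by (intro mult_left_mono) auto
  also have "\<dots> = lse b z" using assms by (simp add: r_def lse_def l_def S_def)
  finally show ?thesis .
qed

text \<open>An identity instead of the usual lower bound by a single summand: the term
  \<open>- b * ln (softmin b z k)\<close> is kept because it pays for the first round later.\<close>

lemma lse_eq_softmin:
  fixes z :: "'m::finite \<Rightarrow> real"
  assumes "0 < b"
  shows "lse b z = - z k - b * ln (real CARD('m)) - b * ln (softmin b z k)"
proof -
  have "ln (softmin b z k) = - (z k / b) - ln (\<Sum>j\<in>UNIV. exp (- (z j / b)))"
    using sum_exp_pos[of "\<lambda>j. - (z j / b)"] by (simp add: softmin_def ln_div)
  then have "b * ln (softmin b z k) = - z k - b * ln (\<Sum>j\<in>UNIV. exp (- (z j / b)))"
    using assms by (simp add: right_diff_distrib)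
  moreover have "lse b z = b * ln (\<Sum>j\<in>UNIV. exp (- (z j / b))) - b * ln (real CARD('m))"
    using sum_exp_pos[of "\<lambda>j. - (z j / b)"] by (simp add: lse_def ln_div right_diff_distrib)
  ultimately show ?thesis by simp
qed

lemma lse_le:
  fixes z :: "'m::finite \<Rightarrow> real"
  assumes "0 < b" "\<And>j. - z j \<le> c"
  shows "lse b z \<le> c"
proof -
  have "(\<Sum>j\<in>UNIV. exp (- (z j / b))) \<le> (\<Sum>j\<in>(UNIV::'m set). exp (c / b))"
    using assms by (intro sum_mono) (simp add: minus_divide_left divide_right_mono del: divide_minus_left)
  then have "(\<Sum>j\<in>UNIV. exp (- (z j / b))) / real CARD('m) \<le> exp (c / b)"
    by (simp add: field_simps)
  then have "ln ((\<Sum>j\<in>UNIV. exp (- (z j / b))) / real CARD('m)) \<le> c / b"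
    using sum_exp_pos[of "\<lambda>j. - (z j / b)"] by (subst ln_le_iff_le_exp) auto
  then show ?thesis using assms(1) by (simp add: lse_def field_simps)
qed

section \<open>Numerical inequalities\<close>

lemma sqrt_Suc_diff_ge:
  assumes "1 \<le> n"
  shows "1 / 2 - 1 / (8 * n) \<le> sqrt n * (sqrt (n + 1) - sqrt n)"
proof -
  have "(n + 1/2 - 1 / (8 * n))\<^sup>2 \<le> n * (n + 1)"
  proof -
    have "(n + 1/2 - 1 / (8 * n))\<^sup>2 = n * (n + 1) - 1 / (8 * n) + 1 / (64 * n\<^sup>2)"
    proof -
      have "n * (1 / (8 * n)) = 1/8" using assms by simp
      moreover have "(n + 1/2 - d)\<^sup>2 = n\<^sup>2 + n + 1/4 - 2 * (n * d) - d + d\<^sup>2" for d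
        by (simp add: power2_eq_square algebra_simps)
      moreover have "(1 / (8 * n))\<^sup>2 = 1 / (64 * n\<^sup>2)" by (simp add: power2_eq_square)
      ultimately show ?thesis by (simp only:) (simp add: power2_eq_square algebra_simps)
    qed
    moreover have "1 / (64 * n\<^sup>2) \<le> 1 / (8 * n)"
      using assms by (intro divide_left_mono) (auto simp: power2_eq_square)
    ultimately show ?thesis by simp
  qed
  then have "n + 1/2 - 1 / (8 * n) \<le> sqrt (n * (n + 1))"
    by (rule real_le_rsqrt)
  then have "n + 1/2 - 1 / (8 * n) \<le> sqrt n * sqrt (n + 1)"
    by (simp only: real_sqrt_mult)
  then show ?thesis using assms by (simp add: right_diff_distrib)
qed

lemma sqrt_half_diff_ge:
  assumes "1 \<le> n"
  shows "1 / 4 \<le> sqrt n * (sqrt n - sqrt (n - 1 / 2))"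
proof -
  have "n * (n - 1/2) \<le> (n - 1/4)\<^sup>2" by (simp add: power2_eq_square algebra_simps)
  then have "sqrt (n * (n - 1/2)) \<le> n - 1/4" using assms by (intro real_le_lsqrt) auto
  then have "sqrt n * sqrt (n - 1/2) \<le> n - 1/4" by (simp only: real_sqrt_mult)
  then show ?thesis using assms by (simp add: right_diff_distrib)
qed

text \<open>The half-integer shifts make the prices of the rounds telescope. The difference equals
  the inverse of the sum of the two roots, and that sum is at most \<open>2 * sqrt x\<close> by
  concavity.\<close>

lemma inverse_sqrt_le:
  assumes "1 \<le> x"
  shows "1 / (2 * sqrt x) \<le> sqrt (x + 1 / 2) - sqrt (x - 1 / 2)"
proof -
  define a where "a = sqrt (x + 1/2)"
  define c where "c = sqrt (x - 1/2)"
  have a2: "a\<^sup>2 = x + 1/2" and c2: "c\<^sup>2 = x - 1/2" using assms by (auto simp: a_def c_def)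
  have pos: "0 < a" "0 < c" using assms by (auto simp: a_def c_def)
  have "(a + c)\<^sup>2 \<le> (2 * sqrt x)\<^sup>2"
    using sum_squares_bound[of a c] assms by (simp add: power2_sum power_mult_distrib a2 c2)
  then have "a + c \<le> 2 * sqrt x" by (rule power2_le_imp_le) (use assms in simp)
  then have "1 / (2 * sqrt x) \<le> 1 / (a + c)" using pos assms by (intro divide_left_mono mult_pos_pos add_pos_pos) simp_all
  also have "\<dots> = a - c"
  proof -
    have "(a - c) * (a + c) = 1" using a2 c2 by (simp add: algebra_simps power2_eq_square)
    then have "1 / (a + c) = (a - c) * (a + c) / (a + c)" by (simp only:)
    also have "\<dots> = a - c" using pos by simp
    finally show ?thesis .
  qed
  finally show ?thesis by (simp add: a_def c_def)
qed

text \<open>The regime \<open>b < 2\<close> of the induction in \<open>regret_bound\<close>;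
  \<open>C\<close> is the price of the first round, and \<open>(2 - b)\<^sup>2 / 2\<close> bounds
  the trade-off between the cost of a new round and the logarithmic term.\<close>

lemma first_round_slack_small_step:
  fixes b C s :: real and n :: nat
  assumes n: "2 \<le> n" and s: "0 < s" and b: "b = sqrt (real n) / s" "b < 2"
    and C: "C \<le> 2" "C \<le> 83/50 * s"
  shows "C + s * (sqrt (real n - 1/2) - sqrt (real n) - sqrt (3/2)) + (2 - b)\<^sup>2 / 2
    \<le> 2 * s * (sqrt (real n + 1) - sqrt (real n))"
proof -
  define r where "r = sqrt (real n)"
  have r: "0 < r" "r\<^sup>2 = real n" using n by (auto simp: r_def)
  have bpos: "0 < b" using s n b by auto
  have sb: "s * b = r" using s by (simp add: b r_def)
  \<comment> \<open>This is what remains after multiplying by \<open>b\<close>, since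
    \<open>s * b = r\<close>. The right-hand side collects 1/4 from \<open>sqrt_half_diff_ge\<close>
    and twice the bound of \<open>sqrt_Suc_diff_ge\<close>.\<close>
  have key: "C * b + b * (2 - b)\<^sup>2 / 2 \<le> 5/4 - 1 / (4 * real n) + r * sqrt (3/2)"
  proof -
    have c1: "C * b \<le> 2 * b" using C bpos by (intro mult_right_mono) auto
    have c2: "C * b \<le> 83/50 * r" 
      using mult_right_mono[OF C(2), of b] bpos sb by (simp add: mult.assoc)
    \<comment> \<open>The value 16/27 is the maximum over [0, 2], attained at b = 2/3.\<close>
    have gen: "b * (2 - b)\<^sup>2 / 2 \<le> 16/27"
    proof -
      have "32/27 - b * (2 - b)\<^sup>2 = (b - 2/3)\<^sup>2 * (8/3 - b)"
        by (simp add: power2_eq_square field_simps)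
      also have "\<dots> \<ge> 0" using b(2) by simp
      finally show ?thesis by simp
    qed
    have dec: "b * (2 - b)\<^sup>2 / 2 \<le> c * (2 - c)\<^sup>2 / 2" if "c \<le> b" "1 \<le> c" for c
    proof -
      define x y where "x = 2 - b" and "y = 2 - c"
      have xy: "0 \<le> x" "x \<le> 1" "0 \<le> y" "y \<le> 1" "x \<le> y" using that b(2) by (auto simp: x_def y_def)
      have "c * (2 - c)\<^sup>2 - b * (2 - b)\<^sup>2 = (y - x) * (x * (1 - x) + y * (1 - y) + x + y * (1 - x))"
        by (simp add: x_def y_def power2_eq_square algebra_simps)
      also have "\<dots> \<ge> 0" using xy by (intro mult_nonneg_nonneg add_nonneg_nonneg) auto
      finally show ?thesis by simp
    qed
    have rm: "r * sqrt (3/2) = sqrt (real n * (3/2))" by (simp add: r_def real_sqrt_mult[symmetric])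
    \<comment> \<open>A threshold \<open>c\<close> separates two estimates. Above it
      \<open>C * b \<le> 83/50 * r\<close> is combined with the monotonicity \<open>dec\<close>;
      below it \<open>C * b \<le> 2 * c\<close> is combined with \<open>gen\<close>. The numbers
      \<open>r'\<close> and \<open>m\<close> are rational bounds for \<open>r\<close> and
      \<open>r * sqrt (3/2)\<close>.\<close>
    have split: ?thesis
      if "c \<in> {1..}" "83/50 * r' + c * (2 - c)\<^sup>2 / 2 \<le> 5/4 - 1 / (4 * real n) + m"
        "2 * c + 16/27 \<le> 5/4 - 1 / (4 * real n) + m" "r \<le> r'" "m \<le> r * sqrt (3/2)" for c r' m
    proof (cases "c \<le> b")
      case True
      then show ?thesis using dec[of c] that c2 by (auto intro: order_trans)
    next
      case False
      then show ?thesis using gen that c1 by auto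
    qed
    consider "n = 2" | "n = 3" | "n = 4" | "n = 5" | "6 \<le> n" using n by linarith
    then show ?thesis
    proof cases
      case 1
      have "r \<le> 14143/10000" unfolding r_def using 1 by (intro real_le_lsqrt) (auto simp: power2_eq_square)
      moreover have "1732/1000 \<le> r * sqrt (3/2)"
        unfolding rm using 1 by (intro real_le_rsqrt) (auto simp: power2_eq_square)
      ultimately show ?thesis
        using split[of "11/10" "14143/10000" "1732/1000"] 1 by (simp add: power2_eq_square)
    next
      case 2
      have "r \<le> 17321/10000" unfolding r_def using 2 by (intro real_le_lsqrt) (auto simp: power2_eq_square)
      moreover have "2121/1000 \<le> r * sqrt (3/2)"
        unfolding rm using 2 by (intro real_le_rsqrt) (auto simp: power2_eq_square)
      ultimately show ?thesis
        using split[of "12/10" "17321/10000" "2121/1000"] 2 by (simp add: power2_eq_square)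
    next
      case 3
      have "r \<le> 2" unfolding r_def using 3 by (intro real_le_lsqrt) (auto simp: power2_eq_square)
      moreover have "2449/1000 \<le> r * sqrt (3/2)"
        unfolding rm using 3 by (intro real_le_rsqrt) (auto simp: power2_eq_square)
      ultimately show ?thesis
        using split[of "14/10" "2" "2449/1000"] 3 by (simp add: power2_eq_square)
    next
      case 4
      have "r \<le> 22361/10000" unfolding r_def using 4 by (intro real_le_lsqrt) (auto simp: power2_eq_square)
      moreover have "2738/1000 \<le> r * sqrt (3/2)"
        unfolding rm using 4 by (intro real_le_rsqrt) (auto simp: power2_eq_square)
      ultimately show ?thesis
        using split[of "16/10" "22361/10000" "2738/1000"] 4 by (simp add: power2_eq_square)
    next
      case 5
      have "b * (2 - b) \<le> 1"
        using zero_le_power2[of "b - 1"] by (simp add: power2_eq_square algebra_simps)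
      then have "b * (2 - b) * (2 - b) \<le> 1 * (2 - b)" using b(2) by (intro mult_right_mono) auto
      moreover have "b * (2 - b)\<^sup>2 = b * (2 - b) * (2 - b)" by (simp add: power2_eq_square)
      ultimately have "C * b + b * (2 - b)\<^sup>2 / 2 \<le> 4" using c1 b(2) by argo
      also have "4 \<le> 5/4 - 1/24 + (3::real)" by simp
      also have "\<dots> \<le> 5/4 - 1 / (4 * real n) + r * sqrt (3/2)"
      proof -
        have "3 \<le> r * sqrt (3/2)" unfolding rm using 5 by (intro real_le_rsqrt) auto
        moreover have "1 / (4 * real n) \<le> 1/24" using 5 by (simp add: field_simps)
        ultimately show ?thesis by linarith
      qed
      finally show ?thesis .
    qed
  qed
  have "b * (C + s * (sqrt (real n - 1/2) - r - sqrt (3/2)) + (2 - b)\<^sup>2 / 2)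
      = C * b + b * (2 - b)\<^sup>2 / 2 - r * (r - sqrt (real n - 1/2)) - r * sqrt (3/2)"
    by (simp add: algebra_simps flip: sb)
  also have "\<dots> \<le> C * b + b * (2 - b)\<^sup>2 / 2 - 1/4 - r * sqrt (3/2)"
    using sqrt_half_diff_ge[of "real n"] n by (simp add: r_def)
  also have "\<dots> \<le> 2 * (1/2 - 1 / (8 * real n))" using key by simp
  also have "\<dots> \<le> 2 * (r * (sqrt (real n + 1) - r))"
    using sqrt_Suc_diff_ge[of "real n"] n by (simp add: r_def)
  also have "\<dots> = b * (2 * s * (sqrt (real n + 1) - r))"
    by (simp add: algebra_simps flip: sb)
  finally show ?thesis using bpos by (simp add: r_def)
qed

text \<open>The counterpart used when the step parameter is at least 2. The 1/2 allowed in
  \<open>C\<close> is the leading term of \<open>sqrt_Suc_diff_ge\<close>; the deficit 1/(8n) there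
  is covered by \<open>s * (sqrt n - sqrt (n - 1/2))\<close>.\<close>

lemma first_round_slack_large_step:
  fixes b C s :: real and n :: nat
  assumes n: "2 \<le> n" and s: "1 \<le> 2 * s" and C: "C \<le> sqrt (3/2) * s + 1/2"
  shows "C + s * (sqrt (real n - 1/2) - sqrt (real n) - sqrt (3/2))
    \<le> sqrt (real n) * (sqrt (real n + 1) - sqrt (real n))"
proof -
  define r where "r = sqrt (real n)"
  have r: "1 \<le> r" "r * r = real n" using n by (auto simp: r_def)
  have "1 / (4 * r) \<le> r - sqrt (real n - 1/2)"
    using sqrt_half_diff_ge[of "real n"] n r(1) by (simp add: r_def[symmetric] divide_le_eq mult.commute)
  then have "s * (1 / (4 * r)) \<le> s * (r - sqrt (real n - 1/2))"
    using s by (intro mult_left_mono) auto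
  moreover have "1 / (8 * real n) \<le> s * (1 / (4 * r))"
  proof -
    have "1 * 1 \<le> (2 * s) * r" using s r by (intro mult_mono) auto
    then show ?thesis using r by (simp add: field_simps flip: r(2))
  qed
  ultimately show ?thesis
    using C sqrt_Suc_diff_ge[of "real n"] n by (simp add: r_def algebra_simps)
qed

section \<open>Numerical constants depending on the number of base functions\<close>

lemma sqrt_ln_ge: "4/5 \<le> sqrt (ln (real M))" if "2 \<le> M" for M :: nat
proof -
  have "ln 2 \<le> ln (real M)" using that by simp
  then show ?thesis
    using ln2_ge_two_thirds by (intro real_le_rsqrt) (simp add: power2_eq_square)
qed

text \<open>Supplies the hypotheses on \<open>C\<close> of the two slack lemmas. For M = 2, 3, 4 the
  second bound on \<open>C\<close> is evaluated; from M = 5 on, \<open>C \<le> 2\<close> suffices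
  because ln M is large enough.\<close>

lemma ln_card_bounds:
  fixes C :: real and M :: nat
  assumes M: "2 \<le> M" and C: "C \<le> 2" "C \<le> 2 * (1 - 1 / real M) + sqrt (ln (real M)) / (2 * sqrt 2)"
  shows "C \<le> 83/50 * sqrt (ln (real M))"
    "C \<le> sqrt (3/2) * sqrt (ln (real M)) + 1/2"
proof -
  define s where "s = sqrt (ln (real M))"
  have sq: "c \<le> s" if "0 \<le> c" "c * c \<le> l" "l \<le> ln (real M)" for c l
    using that unfolding s_def by (intro real_le_rsqrt) (auto simp: power2_eq_square)
  have sq32: "12247/10000 \<le> sqrt (3/2::real)" by (intro real_le_rsqrt) (simp add: power2_eq_square)
  have sq2: "7071/5000 \<le> sqrt (2::real)" by (intro real_le_rsqrt) (simp add: power2_eq_square)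
  have ln4: "4/3 \<le> ln (4::real)"
    using ln2_ge_two_thirds ln_mult[of 2 "2::real"] by simp
  have s45: "4/5 \<le> s" using sqrt_ln_ge[OF M] by (simp add: s_def)
  have "1 / (2 * sqrt 2) \<le> 1 / (2 * (7071/5000 :: real))" using sq2 by (intro divide_left_mono) auto
  then have "s * (1 / (2 * sqrt 2)) \<le> s * (3536/10000)" using s45 by (intro mult_left_mono) (simp_all flip: s_def)
  then have C2: "C \<le> 2 * (1 - 1 / real M) + 3536/10000 * s" using C(2) by (simp add: s_def)
  have step: "C \<le> 83/50 * s \<and> C \<le> sqrt (3/2) * s + 1/2" if "C \<le> 83/50 * s" "C \<le> 12247/10000 * s + 1/2"
    using that mult_right_mono[OF sq32, of s] s45 by linarith
  consider "M = 2" | "M = 3" | "M = 4" | "5 \<le> M" using M by linarith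
  then have "C \<le> 83/50 * s \<and> C \<le> 12247/10000 * s + 1/2"
  proof cases
    case 1
    then show ?thesis using C2 s45 by (auto simp: s_def)
  next
    case 2
    have "27/25 \<le> ln (3::real)"
    proof -
      \<comment> \<open>The tangent inequality at e/3 gives ln 3 at least 2 - e/3, which is accurate
        because 3 is close to e.\<close>
      have "1 - 1 / (3 / exp 1) \<le> ln (3 / exp 1 :: real)" 
        using ln_le_minus_one[of "exp 1 / 3 :: real"] by (simp add: ln_div)
      then show ?thesis using e_less_272 by (simp add: ln_div)
    qed
    then have "103/100 \<le> s" using sq[of "103/100" "27/25"] 2 by simp
    then show ?thesis using C2 2 by auto
  next
    case 3
    have "1154/1000 \<le> s" using sq[of "1154/1000" "4/3"] 3 ln4 by simp
    then show ?thesis using C2 3 by auto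
  next
    case 4
    have "8/5 \<le> ln (5::real)"
    proof -
      \<comment> \<open>The claim is equivalent to e^8 being at most 5^5.\<close>
      have "exp (8::real) = exp 1 ^ 8" using exp_of_nat_mult[of 8 "1::real"] by simp
      also have "\<dots> \<le> (272/100) ^ 8" by (intro power_mono) (use e_less_272 in auto)
      also have "\<dots> \<le> 5 ^ 5" by (simp add: power_divide)
      finally have "ln (exp (8::real)) \<le> ln (5 ^ 5)" by (subst ln_le_cancel_iff) auto
      also have "ln (5 ^ 5) = real 5 * ln (5::real)" by (rule ln_realpow)
      finally show ?thesis by simp
    qed
    then have "126/100 \<le> s"
      using sq[of "126/100" "8/5"] 4 order_trans[of "8/5" "ln 5" "ln (real M)"] by simp
    then show ?thesis using C(1) by auto
  qed
  then show "C \<le> 83/50 * sqrt (ln (real M))" "C \<le> sqrt (3/2) * sqrt (ln (real M)) + 1/2"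
    using step by (auto simp: s_def)
qed

section \<open>Regret with an arbitrary first round\<close>

text \<open>Only mass off the comparator \<open>k\<close> can lose, and two losses differ by at most
  2. A round is therefore cheap once the weights concentrate on \<open>k\<close>.\<close>

lemma regret_step:
  fixes p u :: "'m::finite \<Rightarrow> real"
  assumes "\<And>j. 0 \<le> p j" "sum p UNIV = 1" "\<And>j. \<bar>u j\<bar> \<le> 1"
  shows "(\<Sum>j\<in>UNIV. p j * u j) - u k \<le> 2 * (1 - p k)"
proof -
  have "(\<Sum>j\<in>UNIV. p j * u j) - u k = (\<Sum>j\<in>UNIV. p j * (u j - u k))"
    using assms(2) by (simp add: right_diff_distrib sum_subtractf flip: sum_distrib_right)
  also have "\<dots> = p k * (u k - u k) + (\<Sum>j\<in>UNIV - {k}. p j * (u j - u k))"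
    by (simp add: sum.remove[of _ k])
  also have "\<dots> \<le> 0 + (\<Sum>j\<in>UNIV - {k}. p j * 2)"
  proof -
    have "u j - u k \<le> 2" for j using assms(3)[of j] assms(3)[of k] by (auto simp: abs_le_iff)
    then show ?thesis using assms(1) by (intro add_mono sum_mono mult_left_mono) auto
  qed
  also have "\<dots> = 2 * (1 - p k)"
    using assms(2) by (simp add: sum.remove[of _ k] flip: sum_distrib_right)
  finally show ?thesis .
qed

text \<open>Two prices for a first round with arbitrary weights. The second compares with the
  uniform average of \<open>u\<close>: \<open>lse_add\<close> at z = 0 bounds the potential by it,
  and \<open>regret_step\<close> for uniform weights and losses \<open>- u\<close> bounds how far
  any \<open>u k\<close> exceeds it.\<close>

lemma first_step:
  fixes p u :: "'m::finite \<Rightarrow> real"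
  assumes p: "\<And>j. 0 \<le> p j" "sum p UNIV = 1" and u: "\<And>j. \<bar>u j\<bar> \<le> 1" and b: "0 < b"
  shows "(\<Sum>j\<in>UNIV. p j * u j) + lse b u \<le> 2"
    "(\<Sum>j\<in>UNIV. p j * u j) + lse b u \<le> 2 * (1 - 1 / real CARD('m)) + 1 / (2 * b)"
proof -
  have u': "- u j \<le> 1" "u j \<le> 1" for j using u[of j] by (auto simp: abs_le_iff)
  have "(\<Sum>j\<in>UNIV. p j * u j) \<le> (\<Sum>j\<in>UNIV. p j * 1)"
    using p u' by (intro sum_mono mult_left_mono) auto
  then show "(\<Sum>j\<in>UNIV. p j * u j) + lse b u \<le> 2"
    using lse_le[of b u 1] u' b p(2) by simp
  let ?M = "real CARD('m)"
  have l: "lse b u \<le> - (\<Sum>j\<in>UNIV. u j / ?M) + 1 / (2 * b)"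
    using lse_add[of u b "\<lambda>_. 0"] u b by (simp add: lse_def softmin_def)
  have avg: "u k - (\<Sum>j\<in>UNIV. u j / ?M) \<le> 2 * (1 - 1 / ?M)" for k
    using regret_step[of "\<lambda>_. 1 / ?M" "\<lambda>j. - u j" k] u by (simp add: sum_negf)
  have "(\<Sum>j\<in>UNIV. p j * u j) \<le> (\<Sum>j\<in>UNIV. p j * ((\<Sum>j\<in>UNIV. u j / ?M) + 2 * (1 - 1 / ?M)))"
    using p avg by (intro sum_mono mult_left_mono) (auto simp: algebra_simps)
  also have "\<dots> = (\<Sum>j\<in>UNIV. u j / ?M) + 2 * (1 - 1 / ?M)"
    using p(2) by (simp add: sum_distrib_right[symmetric])
  finally show "(\<Sum>j\<in>UNIV. p j * u j) + lse b u \<le> 2 * (1 - 1 / ?M) + 1 / (2 * b)"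
    using l by simp
qed

text \<open>The algorithm after normalisation: weights
  \<open>p i = \<theta>\<^sub>i / \<lambda>\<close>, losses divided by the constant L, and step
  parameters \<open>b i = \<beta>\<^sub>i / L\<close>. The weights \<open>p i\<close> meet the
  losses \<open>u (Suc i)\<close>.\<close>

locale exp_weights =
  fixes u p :: "nat \<Rightarrow> 'm::finite \<Rightarrow> real" and s :: real and b :: "nat \<Rightarrow> real"
  defines "s \<equiv> sqrt (ln (real CARD('m)))"
    and "b \<equiv> \<lambda>i. sqrt (real i + 1) / s"
  assumes card: "2 \<le> CARD('m)"
    and u: "\<And>i j. \<bar>u i j\<bar> \<le> 1"
    and p0: "\<And>j. 0 \<le> p 0 j" "sum (p 0) UNIV = 1"
    and p: "\<And>i. 1 \<le> i \<Longrightarrow> p i = softmin (b i) (\<lambda>j. \<Sum>l=1..i. u l j)"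
begin

definition "regret k i = (\<Sum>l=1..i. (\<Sum>j\<in>UNIV. p (l - 1) j * u l j) - u l k)"

lemma s: "4 / 5 \<le> s" "s * s = ln (real CARD('m))"
  using sqrt_ln_ge[OF card] card by (auto simp: s_def)

lemma b_pos: "0 < b i"
  using s by (auto simp: b_def intro!: divide_pos_pos)

lemma p_nonneg: "0 \<le> p i j" and p_sum: "sum (p i) UNIV = 1"
  using p0 p[of i] by (cases "i = 0"; auto simp: softmin_nonneg sum_softmin)+

lemma regret_Suc: "regret k (Suc i) = regret k i + ((\<Sum>j\<in>UNIV. p i j * u (Suc i) j) - u (Suc i) k)"
  by (simp add: regret_def)

text \<open>The value after one round of the quantity tracked in \<open>potential\<close>; the
  comparator has cancelled. It is the \<open>C\<close> of the overview.\<close>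

definition "start = (\<Sum>j\<in>UNIV. p 0 j * u 1 j) + lse (b 1) (u 1)"

lemma start_bounds: "start \<le> 2" "start \<le> 83/50 * s" "start \<le> sqrt (3/2) * s + 1/2"
proof -
  show 1: "start \<le> 2" unfolding start_def by (intro first_step p0 u b_pos)
  have "start \<le> 2 * (1 - 1 / real CARD('m)) + 1 / (2 * b 1)"
    unfolding start_def by (intro first_step p0 u b_pos)
  then have 2: "start \<le> 2 * (1 - 1 / real CARD('m)) + sqrt (ln (real CARD('m))) / (2 * sqrt 2)"
    by (simp add: b_def s_def)
  show "start \<le> 83/50 * s" "start \<le> sqrt (3/2) * s + 1/2"
    using ln_card_bounds[OF card 1 2] by (auto simp: s_def)
qed

text \<open>The loss of a round cancels against the linear term of \<open>lse_add\<close>, so each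
  round adds only its price. The induction begins after the first round, since \<open>p 0\<close>
  need not be a \<open>softmin\<close>.\<close>

lemma potential:
  "regret k (Suc i) + lse (b (Suc i)) (\<lambda>j. \<Sum>l=1..Suc i. u l j) + (\<Sum>l=1..Suc i. u l k)
    \<le> start + s * (sqrt (real (Suc i) + 1/2) - sqrt (3/2))"
proof (induction i)
  case 0
  then show ?case by (simp add: regret_def start_def)
next
  case (Suc i)
  let ?n = "Suc i"
  let ?z = "\<lambda>n j. \<Sum>l=1..n. u l j"
  have "lse (b (Suc ?n)) (?z (Suc ?n)) \<le> lse (b ?n) (?z (Suc ?n))"
    using b_pos s by (intro lse_antimono) (auto simp: b_def intro!: divide_right_mono)
  also have "\<dots> = lse (b ?n) (\<lambda>j. ?z ?n j + u (Suc ?n) j)" by simp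
  also have "\<dots> \<le> lse (b ?n) (?z ?n) - (\<Sum>j\<in>UNIV. p ?n j * u (Suc ?n) j) + 1 / (2 * b ?n)"
    using lse_add[of "u (Suc ?n)" "b ?n" "?z ?n"] u b_pos p[of ?n] by simp
  also have "1 / (2 * b ?n) = s * (1 / (2 * sqrt (real (Suc ?n))))"
    by (simp add: b_def algebra_simps)
  also have "\<dots> \<le> s * (sqrt (real (Suc ?n) + 1/2) - sqrt (real (Suc ?n) - 1/2))"
    using s by (intro mult_left_mono inverse_sqrt_le) auto
  finally have "lse (b (Suc ?n)) (?z (Suc ?n)) \<le> lse (b ?n) (?z ?n) - (\<Sum>j\<in>UNIV. p ?n j * u (Suc ?n) j)
      + s * sqrt (real (Suc ?n) + 1/2) - s * sqrt (real ?n + 1/2)"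
    by (simp add: right_diff_distrib add.commute)
  then show ?case using Suc by (simp add: regret_Suc right_diff_distrib)
qed

lemma regret_potential:
  "regret k (Suc i) \<le> start + s * (sqrt (real (Suc i) + 1) + sqrt (real (Suc i) + 1/2) - sqrt (3/2))
    + b (Suc i) * ln (p (Suc i) k)"
proof -
  \<comment> \<open>Because \<open>s * s = ln M\<close>, the entropy term has the same form as the
    accumulated prices.\<close>
  have "b (Suc i) * ln (real CARD('m)) = s * sqrt (real (Suc i) + 1)"
    using s by (simp add: b_def flip: s(2))
  then show ?thesis
    using potential[of k i] lse_eq_softmin[OF b_pos, of "Suc i" "\<lambda>j. \<Sum>l=1..Suc i. u l j" k] p[of "Suc i"]
    by (simp add: right_diff_distrib distrib_left)
qed

theorem regret_bound: "regret k (Suc i) \<le> 2 * s * sqrt (real (Suc i) + 1)"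
proof (induction i)
  case 0
  have "regret k (Suc 0) \<le> 2 * (1 - p 0 k)"
    using regret_step[of "p 0" "u 1" k] u p0 by (simp add: regret_def)
  also have "\<dots> \<le> 2" using p0 by simp
  also have "2 \<le> 2 * s * (5/4)" using s by simp
  also have "\<dots> \<le> 2 * s * sqrt (real (Suc 0) + 1)"
    using s by (intro mult_left_mono real_le_rsqrt) (auto simp: power2_eq_square)
  finally show ?case .
next
  case (Suc i)
  \<comment> \<open>The shift gives \<open>b (Suc i) = sqrt n / s\<close>; the target grows from
    \<open>2 * s * r\<close> to \<open>2 * s * r'\<close>.\<close>
  define n where "n = Suc (Suc i)"
  define q where "q = 1 - p (Suc i) k"
  let ?b = "b (Suc i)"
  define r where "r = sqrt (real n)"
  define r' where "r' = sqrt (real n + 1)"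
  have n: "2 \<le> n" and n': "real n = real (Suc i) + 1" by (auto simp: n_def)
  have half: "real n - 1/2 = real (Suc i) + 1/2" by (simp add: n_def)
  have pk: "0 < p (Suc i) k" using p[of "Suc i"] softmin_pos by simp
  have b: "?b = r / s" "s * ?b = r" "0 < ?b" using s b_pos by (auto simp: b_def r_def n_def)
  have step: "regret k (Suc (Suc i)) \<le> regret k (Suc i) + 2 * q"
    unfolding regret_Suc[of k "Suc i"] q_def by (intro add_left_mono regret_step p_nonneg p_sum u)
  have "regret k (Suc (Suc i)) \<le> 2 * s * r'"
  proof (cases "q \<le> s * (r' - r)")
    case True
    then show ?thesis using step Suc.IH by (simp add: r_def n' algebra_simps)
  next
    case False
    \<comment> \<open>From here on the induction hypothesis is replaced by the potential bound for
      the previous round, whose logarithmic term \<open>ln (1 - q)\<close> offsets the cost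
      \<open>2 * q\<close>.\<close>
    have pot: "regret k (Suc (Suc i)) \<le> start + s * (sqrt (real n - 1/2) - r - sqrt (3/2))
        + 2 * s * r + ?b * ln (1 - q) + 2 * q"
      using step regret_potential[of k i] unfolding half
      by (simp add: n' r_def q_def algebra_simps)
    show ?thesis
    proof (cases "2 \<le> ?b")
      case True
      have "ln (1 - q) \<le> - q" using pk ln_le_minus_one[of "1 - q"] by (simp add: q_def)
      then have "?b * ln (1 - q) \<le> ?b * - q" using b by (intro mult_left_mono) auto
      then have "?b * ln (1 - q) + 2 * q \<le> - ((?b - 2) * q)" by (simp add: algebra_simps)
      \<comment> \<open>For a step parameter of at least 2 a larger \<open>q\<close> only helps, so
        its lower bound from the failed case may be inserted.\<close>
      also have "\<dots> \<le> - ((?b - 2) * (s * (r' - r)))"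
        using True False by (intro le_imp_neg_le mult_left_mono) auto
      also have "\<dots> = 2 * (s * (r' - r)) - r * (r' - r)" by (simp add: algebra_simps flip: b(2))
      finally show ?thesis using pot first_round_slack_large_step[OF n, of s start] start_bounds s
        by (simp add: r_def r'_def algebra_simps)
    next
      case False
      have "?b * ln (1 - q) + 2 * q \<le> (2 - ?b)\<^sup>2 / 2"
      proof -
        \<comment> \<open>The factor \<open>?b / 2\<close> is the maximiser of
          \<open>?b * ln x + 2 * (1 - x)\<close>, so the estimate \<open>ln x \<le> x - 1\<close>
          for the second factor loses nothing at the worst \<open>q\<close>.\<close>
        have e: "1 - q = (?b / 2) * (2 * (1 - q) / ?b)" using b(3) by simp
        have "ln (1 - q) = ln (?b / 2) + ln (2 * (1 - q) / ?b)"
          by (subst e, subst ln_mult) (use b(3) pk in \<open>auto simp: q_def\<close>)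
        also have "\<dots> \<le> (?b / 2 - 1) + (2 * (1 - q) / ?b - 1)"
          using b(3) pk by (intro add_mono ln_le_minus_one) (auto simp: q_def)
        finally have "?b * ln (1 - q) \<le> ?b * ((?b / 2 - 1) + (2 * (1 - q) / ?b - 1))"
          using b(3) by (intro mult_left_mono) auto
        also have "\<dots> = ?b * ?b / 2 - 2 * ?b + 2 * (1 - q)" using b(3) by (simp add: field_simps)
        finally show ?thesis by (simp add: power2_eq_square algebra_simps)
      qed
      moreover have "start + s * (sqrt (real n - 1/2) - r - sqrt (3/2)) + (2 - ?b)\<^sup>2 / 2
          \<le> 2 * s * (r' - r)"
        unfolding r_def r'_def using start_bounds(1,2) s(1) b(1) False
        by (intro first_round_slack_small_step[OF n]) (auto simp: r_def)
      moreover have "2 * s * (r' - r) = 2 * s * r' - 2 * s * r" by (simp add: right_diff_distrib)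
      ultimately show ?thesis using pot by linarith
    qed
  qed
  then show ?case by (simp add: r'_def n' algebra_simps)
qed

end

section \<open>The entropy proxy and its conjugate\<close>

lemma grad_eqI:
  assumes "GDERIV f z :> D"
  shows "grad f z = D"
  unfolding grad_def
proof (rule the_equality[of _ D])
  fix D' assume "GDERIV f z :> D'"
  then have "(\<lambda>h. h \<bullet> D') = (\<lambda>h. h \<bullet> D)"
    using assms unfolding gderiv_def by (rule has_derivative_unique)
  then have "\<forall>h. h \<bullet> D' = h \<bullet> D" by (simp add: fun_eq_iff)
  then show "D' = D" by (simp only: vector_eq_ldot)
qed (fact assms)

lemma inner_vec_real: "x \<bullet> y = (\<Sum>j\<in>UNIV. x $ j * y $ j)" for x y :: "real ^ 'm::finite"
  by (simp add: inner_vec_def)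

lemma softmin_in_lam_simplex: "0 \<le> lam \<Longrightarrow> (\<chi> j. lam * softmin \<beta> z j) \<in> lam_simplex lam"
  by (auto simp: lam_simplex_def softmin_nonneg sum_softmin simp flip: sum_distrib_left)

text \<open>The Gibbs variational principle, with the maximiser \<open>lam\<close> times
  \<open>softmin\<close>.\<close>

lemma conj_proxy_eq_lse:
  fixes z :: "real ^ 'm::finite"
  assumes lam: "0 < lam" and \<beta>: "0 < \<beta>"
  shows "conj_proxy lam \<beta> z = lam * lse \<beta> (($) z)"
proof -
  let ?w = "\<lambda>j. lam * softmin \<beta> (($) z) j"
  let ?M = "real CARD('m)"
  have wpos: "0 < ?w j" for j by (intro mult_pos_pos lam softmin_pos)
  have lnw: "\<beta> * ln (?w j) = \<beta> * ln lam - z $ j - \<beta> * ln ?M - lse \<beta> (($) z)" for j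
    using lse_eq_softmin[OF \<beta>, of "($) z" j] lam softmin_pos[of \<beta> "($) z" j]
    by (simp add: ln_mult distrib_left)
  \<comment> \<open>With \<open>ln (?w j)\<close> in place of \<open>ln (\<theta> $ j)\<close> the
    objective is constant on the simplex, as \<open>ln (?w j)\<close> is affine in
    \<open>z $ j\<close>.\<close>
  have val: "- (z \<bullet> \<theta>) - \<beta> * (lam * ln (?M / lam) + (\<Sum>j\<in>UNIV. \<theta> $ j * ln (?w j)))
      = lam * lse \<beta> (($) z)" if "\<theta> \<in> lam_simplex lam" for \<theta>
  proof -
    have sum: "(\<Sum>j\<in>UNIV. \<theta> $ j) = lam" using that by (simp add: lam_simplex_def)
    have "\<beta> * (\<Sum>j\<in>UNIV. \<theta> $ j * ln (?w j)) = (\<Sum>j\<in>UNIV. \<theta> $ j * (\<beta> * ln (?w j)))"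
      by (simp add: sum_distrib_left algebra_simps)
    also have "\<dots> = (\<Sum>j\<in>UNIV. \<theta> $ j * (\<beta> * ln lam - \<beta> * ln ?M - lse \<beta> (($) z)) - z $ j * \<theta> $ j)"
      by (intro sum.cong refl) (simp add: lnw algebra_simps)
    also have "\<dots> = lam * (\<beta> * ln lam - \<beta> * ln ?M - lse \<beta> (($) z)) - z \<bullet> \<theta>"
      by (simp add: sum_subtractf inner_vec_real sum flip: sum_distrib_right)
    finally show ?thesis using lam by (simp add: ln_div algebra_simps)
  qed
  show ?thesis unfolding conj_proxy_def
  proof (rule cSup_eq_maximum)
    have "(\<chi> j. ?w j) \<in> lam_simplex lam" using lam by (intro softmin_in_lam_simplex) simp
    from val[OF this] have "lam * lse \<beta> (($) z)
        = - (z \<bullet> (\<chi> j. ?w j)) - \<beta> * entropy_proxy lam (\<chi> j. ?w j)"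
      by (simp add: entropy_proxy_def)
    then show "lam * lse \<beta> (($) z)
        \<in> (\<lambda>\<theta>. - (z \<bullet> \<theta>) - \<beta> * entropy_proxy lam \<theta>) ` lam_simplex lam"
      using softmin_in_lam_simplex[of lam \<beta> "($) z"] lam by auto
  next
    fix x assume "x \<in> (\<lambda>\<theta>. - (z \<bullet> \<theta>) - \<beta> * entropy_proxy lam \<theta>) ` lam_simplex lam"
    then obtain \<theta> where \<theta>: "\<theta> \<in> lam_simplex lam" and x: "x = - (z \<bullet> \<theta>) - \<beta> * entropy_proxy lam \<theta>"
      by auto
    \<comment> \<open>Gibbs' inequality term by term. The differences sum to zero because both
      vectors have total mass \<open>lam\<close>.\<close>
    have "\<theta> $ j * ln (?w j) + (\<theta> $ j - ?w j) \<le> \<theta> $ j * ln (\<theta> $ j)" for j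
    proof (cases "\<theta> $ j = 0")
      case True
      then show ?thesis using wpos[of j] by simp
    next
      case False
      then have pos: "0 < \<theta> $ j" using \<theta> by (simp add: lam_simplex_def less_le)
      have "\<theta> $ j * ln (?w j / \<theta> $ j) \<le> \<theta> $ j * (?w j / \<theta> $ j - 1)"
        using pos wpos[of j] by (intro mult_left_mono ln_le_minus_one) auto
      moreover have "ln (?w j / \<theta> $ j) = ln (?w j) - ln (\<theta> $ j)"
        using pos wpos[of j] by (intro ln_divide_pos) auto
      ultimately show ?thesis using pos by (simp add: right_diff_distrib)
    qed
    then have "(\<Sum>j\<in>UNIV. \<theta> $ j * ln (?w j) + (\<theta> $ j - ?w j)) \<le> (\<Sum>j\<in>UNIV. \<theta> $ j * ln (\<theta> $ j))"
      by (rule sum_mono)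
    moreover have "(\<Sum>j\<in>UNIV. \<theta> $ j - ?w j) = 0"
      using \<theta> by (simp add: sum_subtractf lam_simplex_def sum_softmin flip: sum_distrib_left)
    ultimately have "(\<Sum>j\<in>UNIV. \<theta> $ j * ln (?w j)) \<le> (\<Sum>j\<in>UNIV. \<theta> $ j * ln (\<theta> $ j))"
      by (simp add: sum.distrib)
    then have "x \<le> - (z \<bullet> \<theta>) - \<beta> * (lam * ln (?M / lam) + (\<Sum>j\<in>UNIV. \<theta> $ j * ln (?w j)))"
      unfolding x entropy_proxy_def using \<beta> by (intro diff_left_mono mult_left_mono add_left_mono) auto
    then show "x \<le> lam * lse \<beta> (($) z)" using val[OF \<theta>] by simp
  qed
qed

lemma grad_conj_proxy:
  fixes z :: "real ^ 'm::finite"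
  assumes lam: "0 < lam" and \<beta>: "0 < \<beta>"
  shows "grad (conj_proxy lam \<beta>) z = - (\<chi> j. lam * softmin \<beta> (($) z) j)"
proof (rule grad_eqI)
  let ?S = "\<lambda>z::real^'m. \<Sum>j\<in>UNIV. exp (- (z $ j / \<beta>))"
  have vn: "((\<lambda>z::real^'m. z $ j) has_derivative (\<lambda>h. h $ j)) (at z)" for j
    by (rule bounded_linear.has_derivative[OF bounded_linear_vec_nth has_derivative_ident])
  have pos: "0 < ?S z" by (rule sum_exp_pos)
  have dS: "(?S has_derivative (\<lambda>h. \<Sum>j\<in>UNIV. exp (- (z $ j / \<beta>)) * - (h $ j / \<beta>))) (at z)"
  proof (rule has_derivative_sum)
    fix j
    have "((\<lambda>z::real^'m. - (1 / \<beta>) * z $ j) has_derivative (\<lambda>h. - (1 / \<beta>) * h $ j)) (at z)"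
      by (rule has_derivative_mult_right[OF vn])
    then have "((\<lambda>z::real^'m. exp (- (1 / \<beta>) * z $ j)) has_derivative
        (\<lambda>h. - (1 / \<beta>) * h $ j * exp (- (1 / \<beta>) * z $ j))) (at z)"
      by (rule has_derivative_exp)
    then show "((\<lambda>z::real^'m. exp (- (z $ j / \<beta>))) has_derivative
        (\<lambda>h. exp (- (z $ j / \<beta>)) * - (h $ j / \<beta>))) (at z)"
      by (simp add: mult.commute)
  qed
  have "((\<lambda>z. lam * (\<beta> * (ln (?S z) - ln (real CARD('m))))) has_derivative
      (\<lambda>h. lam * (\<beta> * ((\<Sum>j\<in>UNIV. exp (- (z $ j / \<beta>)) * - (h $ j / \<beta>)) * inverse (?S z) - 0)))) (at z)"
    by (intro has_derivative_mult_right has_derivative_diff has_derivative_const has_derivative_ln pos dS)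
  moreover have "lam * (\<beta> * ((\<Sum>j\<in>UNIV. exp (- (z $ j / \<beta>)) * - (h $ j / \<beta>)) * inverse (?S z)))
      = h \<bullet> - (\<chi> j. lam * softmin \<beta> (($) z) j)" for h
    unfolding inner_vec_real sum_distrib_left sum_distrib_right
    using \<beta> by (intro sum.cong) (auto simp: softmin_def divide_inverse)
  moreover have "ln (?S y / real CARD('m)) = ln (?S y) - ln (real CARD('m))" for y
    using sum_exp_pos[of "\<lambda>j. - (y $ j / \<beta>)"] by (simp add: ln_div)
  ultimately have "((\<lambda>z. lam * (\<beta> * (ln (?S z / real CARD('m))))) has_derivative
      (\<lambda>h. h \<bullet> - (\<chi> j. lam * softmin \<beta> (($) z) j))) (at z)"
    by simp
  then show "GDERIV (conj_proxy lam \<beta>) z :> - (\<chi> j. lam * softmin \<beta> (($) z) j)"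
    unfolding gderiv_def conj_proxy_eq_lse[OF lam \<beta>, abs_def] lse_def .
qed

section \<open>Subgradients\<close>

text \<open>The witness is the right derivative, written as the infimum of the right difference
  quotients.\<close>

lemma convex_on_UNIV_supporting_slopes:
  fixes \<phi> :: "real \<Rightarrow> real"
  assumes "convex_on UNIV \<phi>"
  obtains r where "\<And>x y. \<phi> x + r x * (y - x) \<le> \<phi> y"
proof (rule that)
  fix x y
  show "\<phi> x + Inf ((\<lambda>t. (\<phi> x - \<phi> t) / (x - t)) ` ({x<..} \<inter> UNIV)) * (y - x) \<le> \<phi> y"
    using convex_le_Inf_differential[OF assms, of x y] by simp
qed

lemma supporting_slopes_mono:
  fixes \<phi> r :: "real \<Rightarrow> real"
  assumes "\<And>x y. \<phi> x + r x * (y - x) \<le> \<phi> y"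
  shows "mono r"
proof (rule monoI)
  fix x y :: real assume "x \<le> y"
  show "r x \<le> r y"
  proof (cases "x = y")
    case False
    have "r x * (y - x) \<le> r y * (y - x)" using assms[of x y] assms[of y x] by (simp add: algebra_simps)
    then show ?thesis using False \<open>x \<le> y\<close> by simp
  qed simp
qed

text \<open>The supporting lines at \<open>x\<close> and \<open>x + h\<close> trap the difference
  quotient between \<open>r x\<close> and \<open>r (x + h)\<close>.\<close>

lemma supporting_slope_isCont_imp_derivative:
  fixes \<phi> r :: "real \<Rightarrow> real"
  assumes supp: "\<And>x y. \<phi> x + r x * (y - x) \<le> \<phi> y" and cont: "isCont r x"
  shows "(\<phi> has_real_derivative r x) (at x)"
  unfolding DERIV_def
proof (rule tendsto_sandwich)
  have lim: "((\<lambda>h. r (x + h)) \<longlongrightarrow> r x) (at 0)"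
    using cont by (simp add: isCont_iff)
  have bounds: "min (r x) (r (x + h)) \<le> (\<phi> (x + h) - \<phi> x) / h \<and> (\<phi> (x + h) - \<phi> x) / h \<le> max (r x) (r (x + h))"
    if "h \<noteq> 0" for h
  proof -
    have "r x * h \<le> \<phi> (x + h) - \<phi> x" "\<phi> (x + h) - \<phi> x \<le> r (x + h) * h"
      using supp[of x "x + h"] supp[of "x + h" x] by (auto simp: algebra_simps)
    then show ?thesis using that by (cases "0 < h") (auto simp: min_le_iff_disj le_max_iff_disj field_simps)
  qed
  show "\<forall>\<^sub>F h in at 0. min (r x) (r (x + h)) \<le> (\<phi> (x + h) - \<phi> x) / h"
    "\<forall>\<^sub>F h in at 0. (\<phi> (x + h) - \<phi> x) / h \<le> max (r x) (r (x + h))"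
    using bounds by (auto simp: eventually_at_filter)
  show "((\<lambda>h. min (r x) (r (x + h))) \<longlongrightarrow> r x) (at 0)"
    using tendsto_min[OF tendsto_const[of "r x"] lim] by simp
  show "((\<lambda>h. max (r x) (r (x + h))) \<longlongrightarrow> r x) (at 0)"
    using tendsto_max[OF tendsto_const[of "r x"] lim] by simp
qed

text \<open>The slopes \<open>d\<close> and \<open>r\<close> agree off the countable set of jumps of \<open>r\<close>; monotonicity and
  continuity of \<open>\<phi>\<close> carry the subgradient inequality over to the remaining points.\<close>
lemma monotone_derivative_version_subgradient:
  assumes conv: "convex_on UNIV \<phi>" and d: "monotone_derivative_version \<phi> d"
  shows "\<phi> x + d x * (y - x) \<le> \<phi> y"
proof -
  obtain r where supp: "\<And>x y. \<phi> x + r x * (y - x) \<le> \<phi> y"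
    using convex_on_UNIV_supporting_slopes[OF conv] by blast
  have mono_d: "mono d" using d by (simp add: monotone_derivative_version_def)
  have agree: "d z = r z" if "isCont r z" for z
  proof -
    have 1: "(\<phi> has_real_derivative r z) (at z)"
      by (rule supporting_slope_isCont_imp_derivative[OF supp that])
    then have "(\<phi> has_real_derivative d z) (at z)"
      using d unfolding monotone_derivative_version_def by (auto simp: real_differentiable_def)
    with 1 show ?thesis by (rule DERIV_unique[symmetric])
  qed
  have "countable {z. \<not> isCont r z}" by (rule mono_ctble_discont[OF supporting_slopes_mono[OF supp]])
  then have dense: "\<exists>z\<in>{a<..<b}. isCont r z" if "a < b" for a b
    using uncountable_open_interval[of a b] that countable_subset[of "{a<..<b}" "{z. \<not> isCont r z}"] by auto
  have cont: "isCont \<phi> x"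
    using convex_on_continuous[OF open_UNIV conv] by (simp add: continuous_on_eq_continuous_at)
  show ?thesis
  proof (rule ccontr)
    assume "\<not> ?thesis"
    then have neg: "\<phi> y - \<phi> x - d x * (y - x) < 0" by simp
    then have xy: "x \<noteq> y" by auto
    \<comment> \<open>A strict violation at \<open>x\<close> persists at nearby points, among them a
      continuity point of \<open>r\<close> between \<open>x\<close> and \<open>y\<close>, where
      \<open>contra\<close> refutes it.\<close>
    have "isCont (\<lambda>z. \<phi> y - \<phi> z - d x * (y - z)) x" using cont by (intro continuous_intros)
    then have "((\<lambda>z. \<phi> y - \<phi> z - d x * (y - z)) \<longlongrightarrow> \<phi> y - \<phi> x - d x * (y - x)) (at x)"
      by (simp add: isCont_def)
    then have "\<forall>\<^sub>F z in at x. \<phi> y - \<phi> z - d x * (y - z) < 0"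
      using neg by (rule order_tendstoD)
    then obtain e where e: "0 < e" "\<And>z. z \<noteq> x \<Longrightarrow> dist z x < e \<Longrightarrow> \<phi> y - \<phi> z - d x * (y - z) < 0"
      by (auto simp: eventually_at)
    have contra: "d x * (y - z) \<le> \<phi> y - \<phi> z" if "isCont r z" "x < z \<and> z < y \<or> y < z \<and> z < x" for z
    proof -
      have "d x * (y - z) \<le> d z * (y - z)"
        using that(2) monoD[OF mono_d, of x z] monoD[OF mono_d, of z x]
        by (auto intro: mult_right_mono mult_right_mono_neg)
      then show ?thesis using supp[of z y] agree[OF that(1)] by simp
    qed
    show False
    proof (cases "x < y")
      case True
      obtain z where "isCont r z" "x < z" "z < min y (x + e)"
        using dense[of x "min y (x + e)"] True e(1) by auto
      then show False using contra[of z] e(2)[of z] by (auto simp: dist_real_def)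
    next
      case False
      obtain z where "isCont r z" "max y (x - e) < z" "z < x"
        using dense[of "max y (x - e)" x] False xy e(1) by auto
      then show False using contra[of z] e(2)[of z] by (auto simp: dist_real_def)
    qed
  qed
qed

section \<open>Mirror descent\<close>

lemma softmin_scale: "c \<noteq> 0 \<Longrightarrow> softmin (c * b) z = softmin b (\<lambda>j. z j / c)"
  by (simp add: softmin_def fun_eq_iff)

lemma md_beta_eq:
  assumes "2 \<le> M"
  shows "md_beta L M i = L * (sqrt (real i + 1) / sqrt (ln (real M)))"
proof -
  have "ln (real M) powr (- (1/2)) = inverse (sqrt (ln (real M)))"
    using assms by (simp only: powr_minus) (simp add: powr_half_sqrt)
  then show ?thesis by (simp add: md_beta_def field_simps)
qed

section \<open>The simplex as a compact convex set\<close>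

lemma compact_lam_simplex: "compact (lam_simplex lam :: (real ^ 'm::finite) set)"
  unfolding compact_eq_bounded_closed
proof
  show "bounded (lam_simplex lam :: (real ^ 'm) set)"
    unfolding bounded_iff
  proof (intro exI[of _ lam] ballI)
    fix \<theta> :: "real ^ 'm" assume "\<theta> \<in> lam_simplex lam"
    then show "norm \<theta> \<le> lam" using norm_le_l1_cart[of \<theta>] by (simp add: lam_simplex_def)
  qed
  show "closed (lam_simplex lam :: (real ^ 'm) set)"
    unfolding lam_simplex_def
    by (intro closed_Collect_conj closed_Collect_all closed_Collect_le closed_Collect_eq continuous_intros)
qed

lemma convex_lam_simplex: "convex (lam_simplex lam :: (real ^ 'm::finite) set)"
proof (rule convexI)
  fix \<theta> \<theta>' :: "real ^ 'm" and a b :: real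
  assume *: "\<theta> \<in> lam_simplex lam" "\<theta>' \<in> lam_simplex lam" and ab: "0 \<le> a" "0 \<le> b" "a + b = 1"
  have "(\<Sum>j\<in>UNIV. (a *\<^sub>R \<theta> + b *\<^sub>R \<theta>') $ j) = a * lam + b * lam"
    using * by (simp add: lam_simplex_def sum.distrib flip: sum_distrib_left)
  also have "\<dots> = lam" using ab(3) by (metis distrib_right mult_1)
  finally show "a *\<^sub>R \<theta> + b *\<^sub>R \<theta>' \<in> lam_simplex lam"
    using * ab by (auto simp: lam_simplex_def)
qed

context
  fixes lam :: real and \<beta> :: "nat \<Rightarrow> real" and u :: "nat \<Rightarrow> real ^ 'm::finite \<Rightarrow> real ^ 'm" and \<theta>0 :: "real ^ 'm"
  assumes lam: "0 < lam" and \<beta>: "\<And>i. 0 < \<beta> i"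
begin

lemma md_state_Suc:
  "fst (md_state lam \<beta> u \<theta>0 (Suc i)) = fst (md_state lam \<beta> u \<theta>0 i) + u (Suc i) (snd (md_state lam \<beta> u \<theta>0 i))"
  "snd (md_state lam \<beta> u \<theta>0 (Suc i))
    = (\<chi> j. lam * softmin (\<beta> (Suc i)) (($) (fst (md_state lam \<beta> u \<theta>0 (Suc i)))) j)"
  by (simp_all only: md_state.simps(2) Let_def fst_conv snd_conv grad_conj_proxy[OF lam \<beta>] minus_minus)

lemma fst_md_state: "fst (md_state lam \<beta> u \<theta>0 i) = (\<Sum>l=1..i. u l (snd (md_state lam \<beta> u \<theta>0 (l - 1))))"
proof (induction i)
  case (Suc i)
  then show ?case unfolding md_state_Suc(1) by simp
qed simp

lemma snd_md_state_in: "\<theta>0 \<in> lam_simplex lam \<Longrightarrow> snd (md_state lam \<beta> u \<theta>0 i) \<in> lam_simplex lam"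
proof (cases i)
  case (Suc i')
  show ?thesis
    unfolding Suc md_state_Suc(2) using lam by (intro softmin_in_lam_simplex) simp
qed simp

end

text \<open>Causality: this is what makes an iterate a function of past observations only.\<close>

lemma md_state_cong:
  assumes "\<And>l. 1 \<le> l \<Longrightarrow> l \<le> i \<Longrightarrow> u l = v l"
  shows "md_state lam \<beta> u \<theta>0 i = md_state lam \<beta> v \<theta>0 i"
  using assms
proof (induction i)
  case (Suc i)
  then have "md_state lam \<beta> u \<theta>0 i = md_state lam \<beta> v \<theta>0 i" by simp
  moreover have "u (Suc i) = v (Suc i)" using Suc.prems[of "Suc i"] by simp
  ultimately show ?case by (simp only: md_state.simps(2))
qed simp

text \<open>Scaling by \<open>L\<close> and \<open>lam\<close> reduces to
  \<open>exp_weights\<close>. The linear regret against \<open>\<theta>\<close> is the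
  \<open>\<theta>\<close>-weighted sum of the regrets against single coordinates.\<close>

lemma md_regret:
  fixes u :: "nat \<Rightarrow> real ^ 'm::finite \<Rightarrow> real ^ 'm"
  assumes lam: "0 < lam" and L: "0 < L" and card: "2 \<le> CARD('m)"
    and u: "\<And>l \<theta> j. 1 \<le> l \<Longrightarrow> \<theta> \<in> lam_simplex lam \<Longrightarrow> \<bar>u l \<theta> $ j\<bar> \<le> L"
    and \<theta>0: "\<theta>0 \<in> lam_simplex lam" and \<theta>: "\<theta> \<in> lam_simplex lam" and t: "1 \<le> t"
  defines "S \<equiv> \<lambda>i. snd (md_state lam (md_beta L CARD('m)) u \<theta>0 i)"
  shows "(\<Sum>l=1..t. u l (S (l - 1)) \<bullet> (S (l - 1) - \<theta>))
    \<le> 2 * lam * L * sqrt (ln (real CARD('m))) * sqrt (real t + 1)"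
proof -
  have \<beta>: "0 < md_beta L CARD('m) i" for i
    using L card by (auto simp: md_beta_eq intro!: mult_pos_pos divide_pos_pos)
  have S: "S i \<in> lam_simplex lam" for i unfolding S_def by (rule snd_md_state_in[OF lam \<beta> \<theta>0])
  \<comment> \<open>The value 0 at index 0 keeps the bound in \<open>exp_weights\<close> valid at
    every index, as the oracles are bounded only from index 1.\<close>
  define v where "v l j = (if l = 0 then 0 else u l (S (l - 1)) $ j / L)" for l j
  define p where "p i j = S i $ j / lam" for i j
  interpret exp_weights v p "sqrt (ln (real CARD('m)))" "\<lambda>i. sqrt (real i + 1) / sqrt (ln (real CARD('m)))"
  proof unfold_locales
    show "2 \<le> CARD('m)" by fact
    show "\<bar>v i j\<bar> \<le> 1" for i j using u[OF _ S, of i] L by (simp add: v_def)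
    show "0 \<le> p 0 j" for j using S[of 0] lam by (simp add: p_def lam_simplex_def)
    show "sum (p 0) UNIV = 1"
      using S[of 0] lam by (simp add: p_def lam_simplex_def flip: sum_divide_distrib)
    fix i :: nat assume i: "1 \<le> i"
    then obtain i' where i': "i = Suc i'" by (cases i) auto
    have z: "fst (md_state lam (md_beta L CARD('m)) u \<theta>0 i) $ j / L = (\<Sum>l=1..i. v l j)" for j
      unfolding fst_md_state[OF lam \<beta>] sum_component sum_divide_distrib
      by (intro sum.cong) (auto simp: v_def S_def)
    have "S i = (\<chi> j. lam * softmin (md_beta L CARD('m) i)
        (($) (fst (md_state lam (md_beta L CARD('m)) u \<theta>0 i))) j)"
      unfolding S_def i' by (rule md_state_Suc(2)[OF lam \<beta>])
    moreover have "softmin (md_beta L CARD('m) i) (($) (fst (md_state lam (md_beta L CARD('m)) u \<theta>0 i)))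
        = softmin (sqrt (real i + 1) / sqrt (ln (real CARD('m)))) (\<lambda>j. \<Sum>l=1..i. v l j)"
      unfolding md_beta_eq[OF card] z[symmetric] using L by (intro softmin_scale) simp
    ultimately show "p i = softmin (sqrt (real i + 1) / sqrt (ln (real CARD('m)))) (\<lambda>j. \<Sum>l=1..i. v l j)"
      using lam by (simp add: p_def fun_eq_iff)
  qed
  obtain t' where t': "t = Suc t'" using t by (cases t) auto
  have sum\<theta>: "(\<Sum>k\<in>UNIV. \<theta> $ k) = lam" and \<theta>0: "0 \<le> \<theta> $ k" for k
    using \<theta> by (auto simp: lam_simplex_def)
  have "(\<Sum>l=1..t. u l (S (l - 1)) \<bullet> (S (l - 1) - \<theta>)) = (\<Sum>k\<in>UNIV. \<theta> $ k * (L * regret k t))"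
  proof -
    have "u l (S (l - 1)) \<bullet> (S (l - 1) - \<theta>)
        = (\<Sum>k\<in>UNIV. \<theta> $ k * (L * ((\<Sum>j\<in>UNIV. p (l - 1) j * v l j) - v l k)))" if "1 \<le> l" for l
    proof -
      have "(\<Sum>k\<in>UNIV. \<theta> $ k * (L * ((\<Sum>j\<in>UNIV. p (l - 1) j * v l j) - v l k)))
          = (\<Sum>k\<in>UNIV. \<theta> $ k) * (L * (\<Sum>j\<in>UNIV. p (l - 1) j * v l j)) - (\<Sum>k\<in>UNIV. \<theta> $ k * (L * v l k))"
        by (simp add: right_diff_distrib sum_subtractf sum_distrib_right)
      also have "(\<Sum>k\<in>UNIV. \<theta> $ k * (L * v l k)) = u l (S (l - 1)) \<bullet> \<theta>"
        using that L by (simp add: inner_vec_real v_def mult.commute)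
      also have "(\<Sum>k\<in>UNIV. \<theta> $ k) * (L * (\<Sum>j\<in>UNIV. p (l - 1) j * v l j)) = u l (S (l - 1)) \<bullet> S (l - 1)"
        unfolding sum\<theta> sum_distrib_left inner_vec_real using that L lam
        by (intro sum.cong) (auto simp: p_def v_def)
      finally show ?thesis by (simp add: inner_diff_right)
    qed
    then have "(\<Sum>l=1..t. u l (S (l - 1)) \<bullet> (S (l - 1) - \<theta>))
        = (\<Sum>l=1..t. \<Sum>k\<in>UNIV. \<theta> $ k * (L * ((\<Sum>j\<in>UNIV. p (l - 1) j * v l j) - v l k)))"
      by (intro sum.cong) auto
    also have "\<dots> = (\<Sum>k\<in>UNIV. \<Sum>l=1..t. \<theta> $ k * (L * ((\<Sum>j\<in>UNIV. p (l - 1) j * v l j) - v l k)))"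
      by (rule sum.swap)
    finally show ?thesis by (simp only: regret_def sum_distrib_left)
  qed
  also have "\<dots> \<le> (\<Sum>k\<in>UNIV. \<theta> $ k * (L * (2 * sqrt (ln (real CARD('m))) * sqrt (real t + 1))))"
    using L unfolding t' by (intro sum_mono mult_left_mono \<theta>0 regret_bound) auto
  also have "\<dots> = 2 * lam * L * sqrt (ln (real CARD('m))) * sqrt (real t + 1)"
    unfolding sum_distrib_right[symmetric] sum\<theta> by simp
  finally show ?thesis .
qed

section \<open>Excess risk\<close>

lemma borel_measurable_vec_lambda:
  fixes f :: "'a \<Rightarrow> 'm::finite \<Rightarrow> real"
  assumes "\<And>j. (\<lambda>x. f x j) \<in> borel_measurable N"
  shows "(\<lambda>x. \<chi> j. f x j) \<in> borel_measurable N"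
  using assms by (subst borel_measurable_euclidean_space) (auto simp: Basis_vec_def inner_axis)

lemma borel_measurable_vec_nth:
  fixes f :: "'a \<Rightarrow> real ^ 'm::finite"
  assumes "f \<in> borel_measurable N"
  shows "(\<lambda>x. f x $ j) \<in> borel_measurable N"
proof -
  have "(\<lambda>x. f x \<bullet> axis j 1) \<in> borel_measurable N" using assms by measurable
  then show ?thesis by (simp add: inner_axis)
qed

text \<open>Independence turns the joint law into a product, and Fubini integrates out
  \<open>V\<close> with \<open>U\<close> frozen.\<close>

lemma (in prob_space) indep_var_expectation:
  fixes f :: "_ \<Rightarrow> real"
  assumes ind: "indep_var S U T V" and f: "f \<in> borel_measurable (S \<Otimes>\<^sub>M T)"
    and int: "integrable M (\<lambda>\<omega>. f (U \<omega>, V \<omega>))"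
  shows "expectation (\<lambda>\<omega>. f (U \<omega>, V \<omega>)) = expectation (\<lambda>\<omega>. \<integral>z. f (U \<omega>, z) \<partial>distr M T V)"
proof -
  have U [measurable]: "random_variable S U" and V [measurable]: "random_variable T V"
    and eq: "distr M S U \<Otimes>\<^sub>M distr M T V = distr M (S \<Otimes>\<^sub>M T) (\<lambda>x. (U x, V x))"
    using ind by (auto simp: indep_var_distribution_eq)
  interpret S: prob_space "distr M S U" by (rule prob_space_distr) fact
  interpret T: prob_space "distr M T V" by (rule prob_space_distr) fact
  interpret ST: pair_prob_space "distr M S U" "distr M T V" ..
  note f [measurable]
  have int': "integrable (distr M S U \<Otimes>\<^sub>M distr M T V) f"
    unfolding eq using int by (subst integrable_distr_eq) auto
  have "expectation (\<lambda>\<omega>. f (U \<omega>, V \<omega>)) = integral\<^sup>L (distr M S U \<Otimes>\<^sub>M distr M T V) f"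
    unfolding eq by (subst integral_distr) auto
  also have "\<dots> = (\<integral>x. (\<integral>z. f (x, z) \<partial>distr M T V) \<partial>distr M S U)"
    by (rule ST.integral_fst'[symmetric]) (use int' in simp)
  also have "\<dots> = expectation (\<lambda>\<omega>. \<integral>z. f (U \<omega>, z) \<partial>distr M T V)"
    by (rule integral_distr) measurable
  finally show ?thesis .
qed

locale classification_sample = prob_space P for P :: "'w measure" +
  fixes MX :: "'x measure" and X :: "'w \<Rightarrow> 'x" and Y :: "'w \<Rightarrow> real"
    and Xs :: "nat \<Rightarrow> 'w \<Rightarrow> 'x" and Ys :: "nat \<Rightarrow> 'w \<Rightarrow> real"
    and \<phi> d :: "real \<Rightarrow> real" and h :: "'m::finite \<Rightarrow> 'x \<Rightarrow> real"
    and K lam :: real and \<theta>0 :: "real ^ 'm"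
  assumes XY: "(\<lambda>\<omega>. (X \<omega>, Y \<omega>)) \<in> P \<rightarrow>\<^sub>M (MX \<Otimes>\<^sub>M count_space {-1, 1})"
    and indep: "indep_vars (\<lambda>_. MX \<Otimes>\<^sub>M count_space {-1, 1}) (\<lambda>i \<omega>. (Xs i \<omega>, Ys i \<omega>)) {1..}"
    and ident: "\<And>i. i \<ge> 1 \<Longrightarrow>
           distr P (MX \<Otimes>\<^sub>M count_space {-1, 1}) (\<lambda>\<omega>. (Xs i \<omega>, Ys i \<omega>))
           = distr P (MX \<Otimes>\<^sub>M count_space {-1, 1}) (\<lambda>\<omega>. (X \<omega>, Y \<omega>))"
    and conv: "convex_on UNIV \<phi>"
    and d: "monotone_derivative_version \<phi> d"
    and card: "CARD('m) \<ge> 2"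
    and K: "K > 0" and lam: "lam > 0"
    and h: "\<And>j. h j \<in> borel_measurable MX"
    and hK: "\<And>j x. x \<in> space MX \<Longrightarrow> h j x \<in> {- K..K}"
    and L_pos: "0 < L_const d K lam"
    and \<theta>0: "\<theta>0 \<in> lam_simplex lam"
begin

abbreviation "L \<equiv> L_const d K lam"
abbreviation "Z \<equiv> MX \<Otimes>\<^sub>M count_space {-1, 1::real}"
abbreviation "H \<equiv> feature_map h"
text \<open>The iterate takes a data sequence rather than a sample point, so that it can also be
  evaluated on the product space of the past observations.\<close>

abbreviation "state zs i \<equiv> snd (md_state lam (md_beta L CARD('m)) (\<lambda>i. stoch_subgrad d h (fst (zs i)) (snd (zs i))) \<theta>0 i)"
abbreviation "sample \<omega> \<equiv> (\<lambda>i. (Xs i \<omega>, Ys i \<omega>))"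

definition loss :: "real ^ 'm \<Rightarrow> 'x \<times> real \<Rightarrow> real" where
  "loss \<theta> z = \<phi> (snd z * (\<theta> \<bullet> H (fst z)))"

lemma space_Z: "z \<in> space Z \<longleftrightarrow> fst z \<in> space MX \<and> (snd z = -1 \<or> snd z = 1)"
  by (cases z) (auto simp: space_pair_measure)

lemma md_beta_pos: "0 < md_beta L CARD('m) i"
  using L_pos card by (auto simp: md_beta_eq intro!: mult_pos_pos divide_pos_pos)

lemma state_in: "state zs i \<in> lam_simplex lam"
  by (rule snd_md_state_in[OF lam md_beta_pos \<theta>0])

lemma abs_h_le: "z \<in> space Z \<Longrightarrow> \<bar>h j (fst z)\<bar> \<le> K"
  using hK[of "fst z" j] by (auto simp: space_Z abs_le_iff)

lemma margin_bound:
  assumes "\<theta> \<in> lam_simplex lam" "z \<in> space Z"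
  shows "snd z * (\<theta> \<bullet> H (fst z)) \<in> {- (K * lam)..K * lam}"
proof -
  have "\<bar>snd z * (\<theta> \<bullet> H (fst z))\<bar> = \<bar>\<theta> \<bullet> H (fst z)\<bar>"
    using assms(2) by (auto simp: space_Z abs_mult)
  also have "\<dots> \<le> (\<Sum>j\<in>UNIV. \<bar>\<theta> $ j * h j (fst z)\<bar>)"
    unfolding inner_vec_real feature_map_def by (simp add: sum_abs)
  also have "\<dots> \<le> (\<Sum>j\<in>UNIV. \<theta> $ j * K)"
    using assms abs_h_le[OF assms(2)]
    by (intro sum_mono) (auto simp: lam_simplex_def abs_mult intro!: mult_left_mono)
  also have "\<dots> = K * lam"
    using assms(1) by (simp add: lam_simplex_def flip: sum_distrib_right)
  finally show ?thesis by (auto simp: abs_le_iff)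
qed

lemma subgrad_bound:
  assumes "\<theta> \<in> lam_simplex lam" "z \<in> space Z"
  shows "\<bar>stoch_subgrad d h (fst z) (snd z) \<theta> $ j\<bar> \<le> L"
proof -
  let ?a = "snd z * (\<theta> \<bullet> H (fst z))"
  have "mono d" using d by (simp add: monotone_derivative_version_def)
  \<comment> \<open>The supremum in \<open>L_const\<close> bounds its members only over a bounded
    set; monotonicity bounds \<open>d\<close> by its values at the end points.\<close>
  have "bdd_above ((\<lambda>x. \<bar>d x\<bar>) ` {- (K * lam)..K * lam})"
  proof (rule bdd_aboveI2)
    fix x assume "x \<in> {- (K * lam)..K * lam}"
    then have "d (- (K * lam)) \<le> d x" "d x \<le> d (K * lam)" using \<open>mono d\<close> by (auto dest: monoD)
    then show "\<bar>d x\<bar> \<le> \<bar>d (- (K * lam))\<bar> + \<bar>d (K * lam)\<bar>" by linarith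
  qed
  then have "\<bar>d ?a\<bar> \<le> (SUP x\<in>{- (K * lam)..K * lam}. \<bar>d x\<bar>)"
    by (rule cSUP_upper[OF margin_bound[OF assms]])
  then have "\<bar>h j (fst z)\<bar> * \<bar>d ?a\<bar> \<le> L"
    unfolding L_const_def using K abs_h_le[OF assms(2)] by (intro mult_mono) auto
  moreover have "\<bar>snd z\<bar> = 1" using assms(2) by (auto simp: space_Z)
  ultimately show ?thesis
    by (simp add: stoch_subgrad_def feature_map_def abs_mult mult.commute)
qed

lemma loss_diff_le: "loss \<theta> z - loss \<theta>' z \<le> stoch_subgrad d h (fst z) (snd z) \<theta> \<bullet> (\<theta> - \<theta>')"
  using monotone_derivative_version_subgradient[OF conv d,
      of "snd z * (\<theta> \<bullet> H (fst z))" "snd z * (\<theta>' \<bullet> H (fst z))"]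
  by (simp add: loss_def stoch_subgrad_def inner_diff_right inner_diff_left inner_commute algebra_simps)

section \<open>Measurability of losses and iterates\<close>

lemma measurable_phi [measurable]: "\<phi> \<in> borel_measurable borel"
  using convex_on_continuous[OF open_UNIV conv] by (rule borel_measurable_continuous_onI)

lemma measurable_d [measurable]: "d \<in> borel_measurable borel"
  using d by (intro borel_measurable_mono) (simp add: monotone_derivative_version_def)

lemma measurable_H [measurable]: "H \<in> borel_measurable MX"
  using h borel_measurable_vec_lambda[of "\<lambda>x j. h j x" MX] by (simp add: feature_map_def[abs_def])

lemma measurable_label [measurable]: "(\<lambda>z. snd z) \<in> borel_measurable Z"
  by (rule measurable_compose[OF measurable_snd]) simp

lemma measurable_loss [measurable]: "(\<lambda>(\<theta>, z). loss \<theta> z) \<in> borel_measurable (borel \<Otimes>\<^sub>M Z)"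
  unfolding loss_def case_prod_beta by measurable

text \<open>The space \<open>N\<close> is left general: it becomes \<open>P\<close> in
  \<open>measurable_state\<close> and the product space of past observations in
  \<open>expectation_loss_state\<close>.\<close>

lemma measurable_md_state:
  assumes zs: "\<And>l. 1 \<le> l \<Longrightarrow> l \<le> i \<Longrightarrow> zs l \<in> N \<rightarrow>\<^sub>M Z"
  defines "S \<equiv> \<lambda>x i. md_state lam (md_beta L CARD('m)) (\<lambda>l. stoch_subgrad d h (fst (zs l x)) (snd (zs l x))) \<theta>0 i"
  shows "(\<lambda>x. snd (S x i)) \<in> borel_measurable N"
proof -
  have "(\<lambda>x. fst (S x i)) \<in> borel_measurable N \<and> (\<lambda>x. snd (S x i)) \<in> borel_measurable N"
    using zs
  proof (induction i)
    case 0
    then show ?case by (simp add: S_def)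
  next
    case (Suc i)
    then have fs [measurable]: "(\<lambda>x. fst (S x i)) \<in> borel_measurable N" "(\<lambda>x. snd (S x i)) \<in> borel_measurable N"
      by auto
    have [measurable]: "zs (Suc i) \<in> N \<rightarrow>\<^sub>M Z" using Suc.prems by simp
    have "fst (S x (Suc i)) = fst (S x i)
        + stoch_subgrad d h (fst (zs (Suc i) x)) (snd (zs (Suc i) x)) (snd (S x i))" for x
      unfolding S_def by (rule md_state_Suc(1)[OF lam md_beta_pos])
    then have 1 [measurable]: "(\<lambda>x. fst (S x (Suc i))) \<in> borel_measurable N"
      unfolding stoch_subgrad_def by simp
    note [measurable] = borel_measurable_vec_nth[OF 1]
    have "snd (S x (Suc i))
        = (\<chi> j. lam * softmin (md_beta L CARD('m) (Suc i)) (($) (fst (S x (Suc i)))) j)" for x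
      unfolding S_def by (rule md_state_Suc(2)[OF lam md_beta_pos])
    then have "(\<lambda>x. snd (S x (Suc i))) \<in> borel_measurable N"
      unfolding softmin_def by (simp only:) (intro borel_measurable_vec_lambda, measurable)
    with 1 show ?case by blast
  qed
  then show ?thesis ..
qed

lemma measurable_sample: "1 \<le> i \<Longrightarrow> (\<lambda>\<omega>. (Xs i \<omega>, Ys i \<omega>)) \<in> P \<rightarrow>\<^sub>M Z"
  using indep by (auto simp: indep_vars_def)

lemma measurable_state [measurable]: "(\<lambda>\<omega>. state (sample \<omega>) i) \<in> borel_measurable P"
  using measurable_md_state[of i "\<lambda>l \<omega>. (Xs l \<omega>, Ys l \<omega>)" P] measurable_sample by simp

section \<open>Integrability and regularity of the risk\<close>

lemma loss_bounded: "\<exists>B. \<forall>\<theta>\<in>lam_simplex lam. \<forall>z\<in>space Z. norm (loss \<theta> z) \<le> B"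
proof -
  have "compact (\<phi> ` {- (K * lam)..K * lam})"
    using convex_on_continuous[OF open_UNIV conv]
    by (intro compact_continuous_image) (auto intro: continuous_on_subset)
  then obtain B where "\<And>x. x \<in> {- (K * lam)..K * lam} \<Longrightarrow> norm (\<phi> x) \<le> B"
    by (meson compact_imp_bounded bounded_iff imageI)
  then show ?thesis using margin_bound unfolding loss_def by blast
qed

lemma integrable_loss:
  assumes [measurable]: "f \<in> borel_measurable P" and f: "\<And>\<omega>. \<omega> \<in> space P \<Longrightarrow> f \<omega> \<in> lam_simplex lam"
    and Z [measurable]: "g \<in> P \<rightarrow>\<^sub>M Z"
  shows "integrable P (\<lambda>\<omega>. loss (f \<omega>) (g \<omega>))"
proof -
  obtain B where B: "\<And>\<theta> z. \<theta> \<in> lam_simplex lam \<Longrightarrow> z \<in> space Z \<Longrightarrow> norm (loss \<theta> z) \<le> B"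
    using loss_bounded by blast
  show ?thesis
  proof (rule integrable_const_bound[of _ B])
    show "AE \<omega> in P. norm (loss (f \<omega>) (g \<omega>)) \<le> B"
      using B f measurable_space[OF Z] by (intro AE_I2) auto
    show "(\<lambda>\<omega>. loss (f \<omega>) (g \<omega>)) \<in> borel_measurable P"
      using measurable_compose[OF measurable_Pair[OF assms(1) Z] measurable_loss] by simp
  qed
qed

abbreviation "risk \<equiv> phi_risk P X Y \<phi> h"

lemma risk_eq: "risk \<theta> = expectation (\<lambda>\<omega>. loss \<theta> (X \<omega>, Y \<omega>))"
  by (simp add: phi_risk_def loss_def)

lemma measurable_loss1 [measurable]: "loss \<theta> \<in> borel_measurable Z"
  using measurable_compose[OF measurable_Pair1'[of \<theta> borel Z] measurable_loss] by simp

lemma risk_eq_distr: "1 \<le> i \<Longrightarrow> risk \<theta> = (\<integral>z. loss \<theta> z \<partial>distr P Z (\<lambda>\<omega>. (Xs i \<omega>, Ys i \<omega>)))"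
  unfolding ident using XY by (subst integral_distr) (auto simp: risk_eq)

lemma risk_eq_sample: "1 \<le> i \<Longrightarrow> risk \<theta> = expectation (\<lambda>\<omega>. loss \<theta> (Xs i \<omega>, Ys i \<omega>))"
  unfolding risk_eq_distr[of i] using measurable_sample[of i] by (subst integral_distr) auto

lemma measurable_risk [measurable]: "risk \<in> borel_measurable borel"
  unfolding risk_eq[abs_def]
  using measurable_compose[OF measurable_Pair[OF measurable_fst measurable_compose[OF measurable_snd XY]] measurable_loss]
  by (intro borel_measurable_lebesgue_integral) (simp add: case_prod_beta)

text \<open>A crude Lipschitz constant is enough here: it serves to make the risk continuous, hence
  bounded and minimised on the compact simplex.\<close>

lemma risk_diff_le:
  assumes "\<theta> \<in> lam_simplex lam" "\<theta>' \<in> lam_simplex lam"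
  shows "risk \<theta> - risk \<theta>' \<le> real CARD('m) * L * norm (\<theta> - \<theta>')"
proof -
  have int: "integrable P (\<lambda>\<omega>. loss \<theta> (X \<omega>, Y \<omega>))" if "\<theta> \<in> lam_simplex lam" for \<theta>
    using that XY by (intro integrable_loss) auto
  have "risk \<theta> - risk \<theta>' = expectation (\<lambda>\<omega>. loss \<theta> (X \<omega>, Y \<omega>) - loss \<theta>' (X \<omega>, Y \<omega>))"
    using int assms by (simp add: risk_eq)
  also have "\<dots> \<le> expectation (\<lambda>\<omega>. real CARD('m) * L * norm (\<theta> - \<theta>'))"
  proof (rule integral_mono)
    show "integrable P (\<lambda>\<omega>. loss \<theta> (X \<omega>, Y \<omega>) - loss \<theta>' (X \<omega>, Y \<omega>))"
      using int assms by simp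
    fix \<omega> assume "\<omega> \<in> space P"
    then have z: "(X \<omega>, Y \<omega>) \<in> space Z" using measurable_space[OF XY] by blast
    let ?u = "stoch_subgrad d h (X \<omega>) (Y \<omega>) \<theta>"
    have "loss \<theta> (X \<omega>, Y \<omega>) - loss \<theta>' (X \<omega>, Y \<omega>) \<le> ?u \<bullet> (\<theta> - \<theta>')"
      using loss_diff_le[of \<theta> "(X \<omega>, Y \<omega>)" \<theta>'] by simp
    also have "\<dots> \<le> norm ?u * norm (\<theta> - \<theta>')" by (rule norm_cauchy_schwarz)
    also have "norm ?u \<le> (\<Sum>j\<in>UNIV. \<bar>?u $ j\<bar>)" by (rule norm_le_l1_cart)
    also have "\<dots> \<le> (\<Sum>j\<in>(UNIV::'m set). L)"
      using subgrad_bound[OF assms(1) z] by (intro sum_mono) simp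
    finally show "loss \<theta> (X \<omega>, Y \<omega>) - loss \<theta>' (X \<omega>, Y \<omega>) \<le> real CARD('m) * L * norm (\<theta> - \<theta>')"
      by (simp add: mult_right_mono)
  qed simp
  finally show ?thesis by (simp add: prob_space)
qed

lemma risk_continuous: "continuous_on (lam_simplex lam) risk"
proof (rule lipschitz_on_continuous_on[of "real CARD('m) * L"], rule lipschitz_onI)
  fix \<theta> \<theta>' :: "real ^ 'm" assume "\<theta> \<in> lam_simplex lam" "\<theta>' \<in> lam_simplex lam"
  then show "dist (risk \<theta>) (risk \<theta>') \<le> real CARD('m) * L * dist \<theta> \<theta>'"
    using risk_diff_le[of \<theta> \<theta>'] risk_diff_le[of \<theta>' \<theta>]
    by (auto simp: dist_norm norm_minus_commute abs_le_iff)
qed (use L_pos in simp)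

lemma risk_arg_min: "\<exists>\<theta>. is_arg_min risk (\<lambda>\<theta>. \<theta> \<in> lam_simplex lam) \<theta>"
proof -
  have "\<exists>\<theta>\<in>lam_simplex lam. \<forall>\<theta>'\<in>lam_simplex lam. risk \<theta> \<le> risk \<theta>'"
    using compact_lam_simplex \<theta>0 risk_continuous by (intro continuous_attains_inf) auto
  then show ?thesis by (auto simp: is_arg_min_def not_less)
qed

text \<open>The iterate depends only on earlier observations, so averaging over the fresh pair with
  the iterate frozen yields the risk.\<close>

lemma expectation_loss_state:
  assumes i: "1 \<le> i"
  shows "expectation (\<lambda>\<omega>. loss (state (sample \<omega>) (i - 1)) (Xs i \<omega>, Ys i \<omega>))
    = expectation (\<lambda>\<omega>. risk (state (sample \<omega>) (i - 1)))"
proof -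
  let ?A = "{1..i - 1}"
  let ?U = "\<lambda>\<omega>. restrict (\<lambda>i. (Xs i \<omega>, Ys i \<omega>)) ?A"
  \<comment> \<open>a one-element family instead of \<open>(Xs i, Ys i)\<close>: \<open>indep_var\<close> needs both variables of one type\<close>
  let ?V = "\<lambda>\<omega>. restrict (\<lambda>i. (Xs i \<omega>, Ys i \<omega>)) {i}"
  let ?f = "\<lambda>(zs, zs'). loss (state zs (i - 1)) (zs' i)"
  have ind: "indep_var (PiM ?A (\<lambda>_. Z)) ?U (PiM {i} (\<lambda>_. Z)) ?V"
    using i by (intro indep_var_restrict[OF indep]) auto
  then have V: "?V \<in> P \<rightarrow>\<^sub>M PiM {i} (\<lambda>_. Z)" by (rule indep_var_rv2)
  have past: "(\<lambda>zs. state zs (i - 1)) \<in> borel_measurable (PiM ?A (\<lambda>_. Z))"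
    by (rule measurable_md_state[of "i - 1" "\<lambda>l zs. zs l"]) auto
  have present: "(\<lambda>zs. zs i) \<in> PiM {i} (\<lambda>_. Z) \<rightarrow>\<^sub>M Z" by simp
  have f: "?f \<in> borel_measurable (PiM ?A (\<lambda>_. Z) \<Otimes>\<^sub>M PiM {i} (\<lambda>_. Z))"
    using measurable_compose[OF measurable_Pair[OF measurable_compose[OF measurable_fst past]
        measurable_compose[OF measurable_snd present]] measurable_loss]
    by (simp add: case_prod_beta)
  have state: "state (?U \<omega>) (i - 1) = state (sample \<omega>) (i - 1)" for \<omega>
    by (intro arg_cong[where f = snd] md_state_cong) auto
  have fUV: "?f (?U \<omega>, ?V \<omega>) = loss (state (sample \<omega>) (i - 1)) (Xs i \<omega>, Ys i \<omega>)" for \<omega>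
    by (simp only: prod.case state) simp
  have "expectation (\<lambda>\<omega>. ?f (?U \<omega>, ?V \<omega>))
      = expectation (\<lambda>\<omega>. \<integral>zs. ?f (?U \<omega>, zs) \<partial>distr P (PiM {i} (\<lambda>_. Z)) ?V)"
    using integrable_loss[OF measurable_state state_in measurable_sample[OF i]]
    by (intro indep_var_expectation[OF ind f]) (simp only: fUV)
  also have "\<dots> = expectation (\<lambda>\<omega>. risk (state (sample \<omega>) (i - 1)))"
  proof (intro arg_cong[where f = "integral\<^sup>L P"] ext)
    fix \<omega>
    have "(\<integral>zs. ?f (?U \<omega>, zs) \<partial>distr P (PiM {i} (\<lambda>_. Z)) ?V)
        = expectation (\<lambda>\<omega>'. loss (state (sample \<omega>) (i - 1)) (?V \<omega>' i))"
      unfolding prod.case state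
      by (rule integral_distr[OF V measurable_compose[OF present measurable_loss1]])
    then show "(\<integral>zs. ?f (?U \<omega>, zs) \<partial>distr P (PiM {i} (\<lambda>_. Z)) ?V) = risk (state (sample \<omega>) (i - 1))"
      by (simp add: risk_eq_sample[OF i])
  qed
  finally show ?thesis by (simp only: fUV)
qed

lemma average_in:
  assumes "1 \<le> t"
  shows "md_average lam (md_beta L CARD('m)) u \<theta>0 t \<in> lam_simplex lam"
proof -
  have "(\<Sum>i=1..t. (1 / real t) *\<^sub>R snd (md_state lam (md_beta L CARD('m)) u \<theta>0 (i - 1))) \<in> lam_simplex lam"
    using assms by (intro convex_sum convex_lam_simplex snd_md_state_in[OF lam md_beta_pos \<theta>0]) auto
  then show ?thesis by (simp add: md_average_def scaleR_sum_right)
qed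

lemma risk_convex: "convex_on (lam_simplex lam) risk"
proof (rule convex_onI)
  fix a :: real and \<theta> \<theta>' :: "real ^ 'm" assume a: "0 < a" "a < 1" and \<theta>: "\<theta> \<in> lam_simplex lam" "\<theta>' \<in> lam_simplex lam"
  have int: "integrable P (\<lambda>\<omega>. loss \<theta> (X \<omega>, Y \<omega>))" if "\<theta> \<in> lam_simplex lam" for \<theta>
    using that XY by (intro integrable_loss) auto
  have mid: "(1 - a) *\<^sub>R \<theta> + a *\<^sub>R \<theta>' \<in> lam_simplex lam"
    using a \<theta> by (intro convexD[OF convex_lam_simplex]) auto
  have "risk ((1 - a) *\<^sub>R \<theta> + a *\<^sub>R \<theta>')
      \<le> expectation (\<lambda>\<omega>. (1 - a) * loss \<theta> (X \<omega>, Y \<omega>) + a * loss \<theta>' (X \<omega>, Y \<omega>))"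
    unfolding risk_eq
  proof (rule integral_mono)
    fix \<omega>
    have "\<phi> ((1 - a) *\<^sub>R (Y \<omega> * (\<theta> \<bullet> H (X \<omega>))) + a *\<^sub>R (Y \<omega> * (\<theta>' \<bullet> H (X \<omega>))))
        \<le> (1 - a) * \<phi> (Y \<omega> * (\<theta> \<bullet> H (X \<omega>))) + a * \<phi> (Y \<omega> * (\<theta>' \<bullet> H (X \<omega>)))"
      using a by (intro convex_onD[OF conv]) auto
    then show "loss ((1 - a) *\<^sub>R \<theta> + a *\<^sub>R \<theta>') (X \<omega>, Y \<omega>)
        \<le> (1 - a) * loss \<theta> (X \<omega>, Y \<omega>) + a * loss \<theta>' (X \<omega>, Y \<omega>)"
      by (simp add: loss_def inner_add_left algebra_simps)
  qed (use int \<theta> mid in auto)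
  also have "\<dots> = (1 - a) * risk \<theta> + a * risk \<theta>'"
    using int \<theta> by (simp add: risk_eq)
  finally show "risk ((1 - a) *\<^sub>R \<theta> + a *\<^sub>R \<theta>') \<le> (1 - a) * risk \<theta> + a * risk \<theta>'" .
qed (rule convex_lam_simplex)

abbreviation "estimate t \<omega> \<equiv> md_average lam (md_beta L CARD('m)) (\<lambda>i. stoch_subgrad d h (Xs i \<omega>) (Ys i \<omega>)) \<theta>0 t"

lemma risk_estimate_le:
  assumes "1 \<le> t"
  shows "risk (estimate t \<omega>) \<le> (\<Sum>i=1..t. risk (state (sample \<omega>) (i - 1))) / real t"
proof -
  have "risk (\<Sum>i=1..t. (1 / real t) *\<^sub>R state (sample \<omega>) (i - 1))
      \<le> (\<Sum>i=1..t. (1 / real t) * risk (state (sample \<omega>) (i - 1)))"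
    using assms by (intro convex_on_sum[OF _ _ risk_convex] state_in) auto
  then show ?thesis
    by (simp add: md_average_def scaleR_sum_right sum_divide_distrib)
qed

lemma integrable_risk:
  assumes [measurable]: "f \<in> borel_measurable P" and f: "\<And>\<omega>. \<omega> \<in> space P \<Longrightarrow> f \<omega> \<in> lam_simplex lam"
  shows "integrable P (\<lambda>\<omega>. risk (f \<omega>))"
proof -
  have "compact (risk ` lam_simplex lam)"
    by (intro compact_continuous_image risk_continuous compact_lam_simplex)
  then obtain B where "\<And>\<theta>. \<theta> \<in> lam_simplex lam \<Longrightarrow> norm (risk \<theta>) \<le> B"
    by (meson compact_imp_bounded bounded_iff imageI)
  then show ?thesis
    using f by (intro integrable_const_bound[of _ B]) auto
qed

text \<open>Online-to-batch conversion: the pathwise regret bound is integrated, losses become risks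
  by \<open>expectation_loss_state\<close>, and Jensen's inequality passes to the averaged
  iterate.\<close>

lemma excess_risk_bound:
  assumes t: "1 \<le> t" and \<theta>: "\<theta> \<in> lam_simplex lam"
  shows "expectation (\<lambda>\<omega>. risk (estimate t \<omega>)) - risk \<theta>
    \<le> 2 * lam * L * (sqrt (ln (real CARD('m))) * sqrt (real t + 1) / real t)"
proof -
  let ?B = "2 * lam * L * sqrt (ln (real CARD('m))) * sqrt (real t + 1)"
  let ?\<theta> = "\<lambda>\<omega> i. state (sample \<omega>) (i - 1)"
  have int1: "integrable P (\<lambda>\<omega>. loss (?\<theta> \<omega> i) (Xs i \<omega>, Ys i \<omega>))"
    and int2: "integrable P (\<lambda>\<omega>. loss \<theta> (Xs i \<omega>, Ys i \<omega>))" if "1 \<le> i" for i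
    by (rule integrable_loss[OF measurable_state state_in measurable_sample[OF that]],
        rule integrable_loss[OF _ \<theta> measurable_sample[OF that]]) simp
  have int3: "integrable P (\<lambda>\<omega>. risk (?\<theta> \<omega> i))" for i
    by (intro integrable_risk state_in measurable_state)
  have regret: "(\<Sum>i=1..t. loss (?\<theta> \<omega> i) (Xs i \<omega>, Ys i \<omega>) - loss \<theta> (Xs i \<omega>, Ys i \<omega>)) \<le> ?B"
    if "\<omega> \<in> space P" for \<omega>
  proof -
    let ?u = "\<lambda>i. stoch_subgrad d h (fst (sample \<omega> i)) (snd (sample \<omega> i))"
    have z: "sample \<omega> i \<in> space Z" if "1 \<le> i" for i
      using measurable_space[OF measurable_sample[OF that]] \<open>\<omega> \<in> space P\<close> by blast
    have "(\<Sum>i=1..t. loss (?\<theta> \<omega> i) (Xs i \<omega>, Ys i \<omega>) - loss \<theta> (Xs i \<omega>, Ys i \<omega>))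
        \<le> (\<Sum>i=1..t. ?u i (?\<theta> \<omega> i) \<bullet> (?\<theta> \<omega> i - \<theta>))"
      by (intro sum_mono loss_diff_le)
    also have "\<dots> \<le> ?B"
      by (intro md_regret lam L_pos card \<theta>0 \<theta> t subgrad_bound z)
    finally show ?thesis .
  qed
  have "(\<Sum>i=1..t. expectation (\<lambda>\<omega>. risk (?\<theta> \<omega> i))) - real t * risk \<theta>
      = (\<Sum>i=1..t. expectation (\<lambda>\<omega>. risk (?\<theta> \<omega> i)) - risk \<theta>)"
    by (simp add: sum_subtractf)
  also have "\<dots> = (\<Sum>i=1..t. expectation (\<lambda>\<omega>. loss (?\<theta> \<omega> i) (Xs i \<omega>, Ys i \<omega>))
          - expectation (\<lambda>\<omega>. loss \<theta> (Xs i \<omega>, Ys i \<omega>)))"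
  proof (rule sum.cong[OF refl])
    fix i assume "i \<in> {1..t}"
    then have i: "1 \<le> i" by simp
    show "expectation (\<lambda>\<omega>. risk (?\<theta> \<omega> i)) - risk \<theta>
        = expectation (\<lambda>\<omega>. loss (?\<theta> \<omega> i) (Xs i \<omega>, Ys i \<omega>)) - expectation (\<lambda>\<omega>. loss \<theta> (Xs i \<omega>, Ys i \<omega>))"
      by (simp only: expectation_loss_state[OF i] risk_eq_sample[OF i, of \<theta>])
  qed
  also have "\<dots> = expectation (\<lambda>\<omega>. \<Sum>i=1..t. loss (?\<theta> \<omega> i) (Xs i \<omega>, Ys i \<omega>) - loss \<theta> (Xs i \<omega>, Ys i \<omega>))"
    using int1 int2 by simp
  also have "\<dots> \<le> expectation (\<lambda>\<omega>. ?B)"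
    using int1 int2 regret by (intro integral_mono) auto
  also have "\<dots> = ?B" by (simp add: prob_space)
  finally have sum: "(\<Sum>i=1..t. expectation (\<lambda>\<omega>. risk (?\<theta> \<omega> i))) \<le> ?B + real t * risk \<theta>" by simp
  have "expectation (\<lambda>\<omega>. risk (estimate t \<omega>)) \<le> expectation (\<lambda>\<omega>. (\<Sum>i=1..t. risk (?\<theta> \<omega> i)) / real t)"
  proof (rule integral_mono)
    have "(\<lambda>\<omega>. estimate t \<omega>) \<in> borel_measurable P"
      unfolding md_average_def using measurable_state by (intro borel_measurable_scaleR borel_measurable_sum) auto
    then show "integrable P (\<lambda>\<omega>. risk (estimate t \<omega>))"
      using average_in[OF t] by (intro integrable_risk) auto
  qed (use int3 risk_estimate_le[OF t] in auto)
  also have "\<dots> = (\<Sum>i=1..t. expectation (\<lambda>\<omega>. risk (?\<theta> \<omega> i))) / real t"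
    using int3 by simp
  also have "\<dots> \<le> (?B + real t * risk \<theta>) / real t" using sum by (rule divide_right_mono) simp
  also have "\<dots> = 2 * lam * L * (sqrt (ln (real CARD('m))) * sqrt (real t + 1) / real t) + risk \<theta>"
    using t by (simp add: add_divide_distrib)
  finally show ?thesis by simp
qed

end

theorem theorem1:
  fixes P :: "'w measure" and MX :: "'x measure"
    and X :: "'w \<Rightarrow> 'x" and Y :: "'w \<Rightarrow> real"
    and Xs :: "nat \<Rightarrow> 'w \<Rightarrow> 'x" and Ys :: "nat \<Rightarrow> 'w \<Rightarrow> real"
    and \<phi> \<phi>' :: "real \<Rightarrow> real"
    and h :: "'m::finite \<Rightarrow> 'x \<Rightarrow> real"
    and K lam :: real and \<theta>0 :: "real ^ 'm" and t :: nat
  assumes "prob_space P"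
    and "(\<lambda>\<omega>. (X \<omega>, Y \<omega>)) \<in> P \<rightarrow>\<^sub>M (MX \<Otimes>\<^sub>M count_space {-1, 1})"
    and "prob_space.indep_vars P (\<lambda>_. MX \<Otimes>\<^sub>M count_space {-1, 1})
           (\<lambda>i \<omega>. (Xs i \<omega>, Ys i \<omega>)) {1..}"
    and "\<And>i. i \<ge> 1 \<Longrightarrow>
           distr P (MX \<Otimes>\<^sub>M count_space {-1, 1}) (\<lambda>\<omega>. (Xs i \<omega>, Ys i \<omega>))
           = distr P (MX \<Otimes>\<^sub>M count_space {-1, 1}) (\<lambda>\<omega>. (X \<omega>, Y \<omega>))"
    and "convex_on UNIV \<phi>" and "\<And>x. 0 \<le> \<phi> x"
    and "monotone_derivative_version \<phi> \<phi>'"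
    and "CARD('m) \<ge> 2"
    and "K > 0" and "lam > 0"
    and "\<And>j. h j \<in> borel_measurable MX"
    and "\<And>j x. x \<in> space MX \<Longrightarrow> h j x \<in> {- K..K}"
    and "\<And>i. 0 < md_beta (L_const \<phi>' K lam) CARD('m) i"
    and "\<theta>0 \<in> lam_simplex lam"
    and "t \<ge> 1"
  shows "\<exists>\<theta>min. is_arg_min (phi_risk P X Y \<phi> h) (\<lambda>\<theta>. \<theta> \<in> lam_simplex lam) \<theta>min \<and>
     (\<integral>\<omega>. phi_risk P X Y \<phi> h
            (md_estimate \<phi>' h K lam \<theta>0 (\<lambda>i. Xs i \<omega>) (\<lambda>i. Ys i \<omega>) t) \<partial>P)
       - phi_risk P X Y \<phi> h \<theta>min
     \<le> (2 * lam * L_const \<phi>' K lam) * (sqrt (ln (real CARD('m))) * sqrt (real t + 1) / real t)"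
proof -
  \<comment> \<open>Positivity of the step parameter at index 0 gives
    \<open>0 < L_const \<phi>' K lam\<close>, the form required by
    \<open>classification_sample\<close>.\<close>
  have "0 < sqrt (ln (real CARD('m)))" using assms(8) by simp
  then have L: "0 < L_const \<phi>' K lam"
    using assms(13)[of 0] by (simp add: md_beta_eq[OF assms(8)] zero_less_divide_iff zero_less_mult_iff)
  interpret prob_space P by fact
  interpret classification_sample P MX X Y Xs Ys \<phi> \<phi>' h K lam \<theta>0
    using assms L by unfold_locales auto
  obtain \<theta> where \<theta>: "is_arg_min risk (\<lambda>\<theta>. \<theta> \<in> lam_simplex lam) \<theta>" using risk_arg_min by blast
  then show ?thesis
    using excess_risk_bound[OF assms(15), of \<theta>] by (auto simp: md_estimate_def is_arg_min_def)
qed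

end
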